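(* Let $Y\sim G$ be a random variable with values in $\mathbb{R}_+=[0,\infty)$ having finite moments of all positive integer orders, and let $G$ be absolutely continuous on $\mathbb{R}_{+,x_0}=[x_0,\infty)$ with $x_0>\mathrm{e}$ and density $G'(x)=g(x)>0$ on $\mathbb{R}_{+,x_0}$. Let $a>0$ and $\alpha\in[0,1]$, and let $\phi$ be any one of the three functions $$\phi_1(x)=a(\log x)^{\alpha},\qquad \phi_2(x)=a(\log x)^{\alpha}+\log\log x,\qquad \phi_3(x)=\frac{a(\log x)^{\alpha}}{\log\log x}\qquad (x>\mathrm{e}).$$ Suppose that $$\limsup_{x\to\infty}\frac{g((x+\phi(x))^2)}{g(x^2)}<1.$$ Then the moments of $Y$ satisfy Carleman's condition $$\sum_{n=1}^{\infty}\left(\mathsf{E}[Y^{n}]\right)^{-1/(2n)}=\infty,$$ and hence $Y$ is M-det on $\mathbb{R}_+$.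
   Context: $Y\sim G$ means that the random variable $Y$ has distribution (function) $G$. The distribution $G$ is arbitrary on $[0,x_0)$; only its restriction to $[x_0,\infty)$ is assumed absolutely continuous. M-determinacy: a random variable with values in $\mathbb{R}_+$ and finite moments of all orders is M-det (moment-determinate) on $\mathbb{R}_+$ if no probability distribution on $\mathbb{R}_+$ other than its own has the same moment sequence (moments of all orders $n\in\mathbb{N}=\{1,2,\ldots\}$). *)

theory Defs
  imports "HOL-Probability.Probability"
begin

definition phi1 :: "real \<Rightarrow> real \<Rightarrow> real \<Rightarrow> real" where
  "phi1 a \<alpha> x = a * ln x powr \<alpha>"

definition phi2 :: "real \<Rightarrow> real \<Rightarrow> real \<Rightarrow> real" where
  "phi2 a \<alpha> x = a * ln x powr \<alpha> + ln (ln x)"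

definition phi3 :: "real \<Rightarrow> real \<Rightarrow> real \<Rightarrow> real" where
  "phi3 a \<alpha> x = a * ln x powr \<alpha> / ln (ln x)"

(* A function is absolutely continuous on every [x0,x] iff it is the indefinite Lebesgue
   integral of an integrable function there.  Here g is any version of the derivative (density). *)
definition abs_cont_from_with_density ::
    "(real \<Rightarrow> real) \<Rightarrow> real \<Rightarrow> (real \<Rightarrow> real) \<Rightarrow> bool" where
  "abs_cont_from_with_density G x0 g \<longleftrightarrow>
     (\<forall>x\<ge>x0. set_integrable lborel {x0..x} g \<and>
             G x = G x0 + set_lebesgue_integral lborel {x0..x} g)"

definition nonneg_distribution_finite_moments :: "real measure \<Rightarrow> bool" where
  "nonneg_distribution_finite_moments D \<longleftrightarrow>
     real_distribution D \<and> (AE x in D. 0 \<le> x) \<and> (\<forall>n\<ge>1. integrable D (\<lambda>x. x ^ n))"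

definition moment_determinate_nonneg :: "real measure \<Rightarrow> bool" where
  "moment_determinate_nonneg D \<longleftrightarrow>
     nonneg_distribution_finite_moments D \<and>
     (\<forall>D'. nonneg_distribution_finite_moments D' \<longrightarrow>
           (\<forall>n\<ge>1. (\<integral>x. x ^ n \<partial>D') = (\<integral>x. x ^ n \<partial>D)) \<longrightarrow> D' = D)"

(* The sum runs over n + 1 = 1, 2, ... and is taken in the extended nonnegative reals.
   A vanishing moment would contribute 0 (since 0 powr r = 0) rather than infinity, so this is
   the usual condition only for nonnegative variables that are not almost surely 0. *)
definition carleman_condition_nonneg :: "'a measure \<Rightarrow> ('a \<Rightarrow> real) \<Rightarrow> bool" where
  "carleman_condition_nonneg M Y \<longleftrightarrow>
     (\<Sum>n. ennreal ((\<integral>\<omega>. Y \<omega> ^ Suc n \<partial>M) powr (- 1 / (2 * real (Suc n))))) = \<infinity>"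

end

theory Submission
  imports Defs "HOL-Real_Asymp.Real_Asymp"
begin

text \<open>
The theorem combines a growth estimate for moments with Carleman's criterion on the half line, and both
are proved here.

For the growth, \<open>S y = (sqrt y + \<phi> (sqrt y))\<^sup>2\<close> is a map close to the identity, and the limsup hypothesis
says that passing from \<open>y\<close> to \<open>S y\<close> multiplies the density by at most some \<open>\<rho> < 1\<close>. Substituting \<open>S\<close> into
the integral of \<open>x ^ n\<close> therefore gains the factor \<open>\<rho>\<close> against \<open>(S y / y) ^ n\<close>. In all three cases \<open>\<phi>\<close> is at
most a multiple of the logarithm (\<open>phi_growth\<close>), so \<open>(S y / y) ^ n\<close> is close to 1 unless \<open>sqrt y\<close> is below a
multiple of \<open>n * ln n\<close>. The part of the integral beyond that threshold is thus absorbed by a fraction of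
the moment itself, and the moment is at most \<open>(A * n * ln n) ^ (2 * n)\<close> (\<open>moment_bound_by_substitution\<close>,
\<open>moment_growth\<close>). Carleman's series then dominates the divergent sum of the terms \<open>1 / (n * ln n)\<close>.

For the criterion (\<open>carleman_imp_moment_determinate_nonneg\<close>), let two laws on the half line have the same
moments. Their square roots have the same even moments, so the difference of the cosine transforms of
the roots is a smooth function that is flat at 0, with derivatives bounded by moments. Carleman's
condition, through Carleman's inequality (\<open>carleman_inequality_summable\<close>), puts this function into a
quasi-analytic class, where a flat function vanishes; this is the Denjoy-Carleman theorem, proved by Bang's
elementary argument (\<open>quasianalytic_step\<close>, \<open>quasianalytic_vanishing\<close>). Equal cosine transforms give equal
laws after symmetrisation, by Levy's uniqueness theorem.
\<close>

section \<open>Carleman's inequality and quasi-analyticity\<close>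

text \<open>
The qualitative form of Carleman's inequality. The plain AM-GM bound on the geometric mean of
\<open>a 0, \<dots>, a n\<close> is too weak, since the averages of a summable sequence need not be summable. The cure is
to apply AM-GM to \<open>c i * a i\<close>, with weights chosen so that the geometric mean of \<open>c 0, \<dots>, c n\<close> is
exactly \<open>n + 2\<close>; the arithmetic means then carry a summable factor.
\<close>

lemma carleman_inequality_summable:
  fixes a :: "nat \<Rightarrow> real"
  assumes nonneg: "\<And>n. 0 \<le> a n" and "summable a"
  shows "summable (\<lambda>n. (\<Prod>i\<le>n. a i) powr (1 / real (Suc n)))"
proof -
  define c :: "nat \<Rightarrow> real" where "c i = real (i + 2) ^ Suc i / real (Suc i) ^ i" for i
  have c_pos: "c i > 0" for i by (simp add: c_def)
  \<comment> \<open>The product telescopes.\<close>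
  have prod_c: "(\<Prod>i\<le>n. c i) = real (n + 2) ^ Suc n" for n
  proof (induction n)
    case (Suc n)
    have "c (Suc n) = real (Suc n + 2) ^ Suc (Suc n) / real (n + 2) ^ Suc n"
      by (simp add: c_def)
    then show ?case by (simp add: Suc.IH del: power_Suc)
  qed (simp add: c_def)
  have c_le: "c i \<le> real (Suc i) * exp 1" for i
  proof -
    have "c i = real (Suc i) * (1 + 1 / real (Suc i)) ^ Suc i"
    proof -
      have "1 + 1 / real (Suc i) = real (i + 2) / real (Suc i)" by (simp add: field_simps)
      then show ?thesis by (simp add: c_def power_divide)
    qed
    also have "(1 + 1 / real (Suc i)) ^ Suc i \<le> exp 1"
      using exp_ge_one_plus_x_over_n_power_n[of "Suc i" 1] by simp
    finally show ?thesis by (simp add: mult_left_mono)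
  qed
  define s where "s n = (\<Sum>i<n. c i * a i)" for n
  have s_nonneg: "s n \<ge> 0" for n
    unfolding s_def using c_pos nonneg by (intro sum_nonneg mult_nonneg_nonneg) (auto intro: less_imp_le)
  have gm: "(\<Prod>i\<le>n. a i) powr (1 / real (Suc n)) \<le> s (Suc n) / (real (Suc n) * real (n + 2))" for n
  proof -
    have "(\<Prod>i\<le>n. c i * a i) powr (1 / real (Suc n)) \<le> s (Suc n) / real (Suc n)"
      using arith_geom_mean[of "{..n}" "\<lambda>i. c i * a i"] c_pos nonneg
      by (simp add: s_def lessThan_Suc_atMost sum_divide_distrib less_imp_le)
    moreover have "(\<Prod>i\<le>n. c i * a i) powr (1 / real (Suc n))
        = real (n + 2) * (\<Prod>i\<le>n. a i) powr (1 / real (Suc n))"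
    proof -
      have "(real (n + 2) ^ Suc n) powr (1 / real (Suc n)) = real (n + 2)"
        by (simp add: powr_realpow[symmetric] powr_powr del: power_Suc)
      then show ?thesis
        unfolding prod.distrib prod_c by (subst powr_mult) (auto intro!: prod_nonneg nonneg)
    qed
    ultimately have "real (n + 2) * (\<Prod>i\<le>n. a i) powr (1 / real (Suc n)) \<le> s (Suc n) / real (Suc n)"
      by simp
    then show ?thesis
      by (simp add: divide_divide_eq_left[symmetric] pos_le_divide_eq mult.commute
          del: divide_divide_eq_left of_nat_Suc of_nat_add)
  qed
  \<comment> \<open>Summation by parts for the weights \<open>1 / ((n + 1) * (n + 2))\<close>, a telescoping difference.\<close>
  have tele: "(\<Sum>n<N. s (Suc n) / (real (Suc n) * real (n + 2))) + s N / real (Suc N)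
      = (\<Sum>i<N. c i * a i / real (Suc i))" for N
  proof (induction N)
    case (Suc N)
    have "s (Suc N) / (real (Suc N) * real (N + 2)) + s (Suc N) / real (N + 2)
        = s (Suc N) / real (Suc N)"
    proof -
      have "x / (p * (p + 1)) + x / (p + 1) = x / p" if "p > 0" for x p :: real
        using that by (simp add: divide_simps) (simp add: algebra_simps)
      from this[of "real (Suc N)" "s (Suc N)"] show ?thesis by (simp add: add.commute)
    qed
    also have "\<dots> = s N / real (Suc N) + c N * a N / real (Suc N)"
      by (simp add: s_def add_divide_distrib)
    finally show ?case using Suc by simp
  qed (simp add: s_def)
  show ?thesis
  proof (rule summableI_nonneg_bounded)
    show "0 \<le> (\<Prod>i\<le>n. a i) powr (1 / real (Suc n))" for n
      by (simp add: prod_nonneg nonneg)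
    show "(\<Sum>n<N. (\<Prod>i\<le>n. a i) powr (1 / real (Suc n))) \<le> exp 1 * suminf a" for N
    proof -
      have "(\<Sum>n<N. (\<Prod>i\<le>n. a i) powr (1 / real (Suc n)))
          \<le> (\<Sum>n<N. s (Suc n) / (real (Suc n) * real (n + 2)))"
        by (intro sum_mono gm)
      also have "\<dots> \<le> (\<Sum>i<N. c i * a i / real (Suc i))"
        using tele[of N] s_nonneg[of N] by (smt (verit) divide_nonneg_nonneg of_nat_0_le_iff)
      also have "\<dots> \<le> (\<Sum>i<N. exp 1 * a i)"
      proof (intro sum_mono)
        fix i
        have "c i * a i \<le> (real (Suc i) * exp 1) * a i"
          using c_le nonneg by (intro mult_right_mono) auto
        then show "c i * a i / real (Suc i) \<le> exp 1 * a i"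
          by (simp add: field_simps)
      qed
      also have "\<dots> \<le> exp 1 * suminf a"
        unfolding sum_distrib_left[symmetric]
        using assms by (intro mult_left_mono sum_le_suminf) auto
      finally show ?thesis .
    qed
  qed
qed

text \<open>
This passes from the root form of Carleman's condition to the ratio form used for quasi-analyticity:
\<open>M 0 / M (Suc n)\<close> is the telescoping product of the ratios \<open>M i / M (Suc i)\<close>, so its root is their
geometric mean.
\<close>

lemma geometric_mean_ratio_divergence:
  fixes M :: "nat \<Rightarrow> real"
  assumes pos: "\<And>n. M n > 0"
    and "\<not> summable (\<lambda>n. (M 0 / M (Suc n)) powr (1 / real (Suc n)))"
  shows "\<not> summable (\<lambda>n. M n / M (Suc n))"
proof
  assume "summable (\<lambda>n. M n / M (Suc n))"
  then have "summable (\<lambda>n. (\<Prod>i\<le>n. M i / M (Suc i)) powr (1 / real (Suc n)))"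
    using pos by (intro carleman_inequality_summable) (auto intro: less_imp_le)
  moreover have "(\<Prod>i\<le>n. M i / M (Suc i)) = M 0 / M (Suc n)" for n
    using pos[THEN less_imp_neq] by (induction n) (auto simp: field_simps)
  ultimately show False using assms by simp
qed

lemma log_convex_growth:
  fixes M :: "nat \<Rightarrow> real"
  assumes pos: "\<And>n. M n > 0"
    and convex: "\<And>n. M (Suc n) ^ 2 \<le> M n * M (Suc (Suc n))"
    and "n + j \<le> Suc K"
  shows "M (n + j) \<le> (M (Suc K) / M K) ^ j * M n"
  using assms(3)
proof (induction j)
  case (Suc j)
  have "M (Suc n) / M n \<le> M (Suc (Suc n)) / M (Suc n)" for n
    using convex[of n] pos[of n] pos[of "Suc n"] by (simp add: field_simps power2_eq_square)
  then have "incseq (\<lambda>n. M (Suc n) / M n)"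
    by (rule incseq_SucI)
  then have "M (Suc (n + j)) / M (n + j) \<le> M (Suc K) / M K"
    using Suc.prems by (auto dest: incseqD[of _ "n + j" K])
  then have "M (Suc (n + j)) \<le> M (Suc K) / M K * M (n + j)"
    using pos[of "n + j"] by (simp add: field_simps)
  also have "\<dots> \<le> M (Suc K) / M K * ((M (Suc K) / M K) ^ j * M n)"
    using Suc pos by (intro mult_left_mono) (auto intro: less_imp_le)
  finally show ?case by simp
qed simp

text \<open>
This is Bang's argument. Think of \<open>f n\<close> as the \<open>n\<close>-th derivative of a function whose derivatives are
bounded by \<open>M\<close>; their mutual relation is expressed by Taylor's formula with remainder. A point \<open>t\<close> has flatness level \<open>K\<close> if \<open>\<bar>f n t\<bar> \<le> exp (n - K) * M n\<close> for all \<open>n\<close>. For \<open>n \<ge> K\<close> this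
follows from the global bound, so only finitely many derivatives have to be controlled, and a Taylor
expansion up to order \<open>Suc K\<close> shows that moving by \<open>M K / (e * M (Suc K))\<close> costs at most one level. At
order \<open>Suc K\<close> the level bound agrees with the global bound, so the Taylor remainder is simply the last
term of the exponential sum.
\<close>

lemma quasianalytic_step:
  fixes f :: "nat \<Rightarrow> real \<Rightarrow> real" and M :: "nat \<Rightarrow> real"
  assumes pos: "\<And>n. M n > 0"
    and convex: "\<And>n. M (Suc n) ^ 2 \<le> M n * M (Suc (Suc n))"
    and taylor: "\<And>n m t h. \<bar>f n (t + h) - (\<Sum>j<m. f (n + j) t * h ^ j / fact j)\<bar>
                   \<le> M (n + m) * \<bar>h\<bar> ^ m / fact m"
    and level: "\<And>n. \<bar>f n t\<bar> \<le> exp (real n - real (Suc K)) * M n"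
    and h: "0 \<le> h" "exp 1 * h \<le> M K / M (Suc K)"
  shows "\<bar>f n (t + h)\<bar> \<le> exp (real n - real K) * M n"
proof (cases "n \<le> K")
  case False
  have "\<bar>f n (t + h)\<bar> \<le> M n" using taylor[of n t h 0] by simp
  also have "\<dots> \<le> exp (real n - real K) * M n"
    using False pos[of n] by simp
  finally show ?thesis .
next
  case True
  define m where "m = Suc K - n"
  have nm: "n + m = Suc K" using True by (simp add: m_def)
  define \<mu> where "\<mu> = M (Suc K) / M K"
  have \<mu>: "\<mu> > 0" "exp 1 * h * \<mu> \<le> 1"
    using pos[of K] pos[of "Suc K"] h by (simp_all add: \<mu>_def field_simps)
  have summand: "exp (real (n + j) - real (Suc K)) * M (n + j) * h ^ j / fact j
      \<le> exp (real n - real (Suc K)) * M n * ((exp 1 * h * \<mu>) ^ j / fact j)" if "j \<le> m" for j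
  proof -
    have "M (n + j) \<le> \<mu> ^ j * M n"
      unfolding \<mu>_def using that nm by (intro log_convex_growth pos convex) auto
    then have "exp (real (n + j) - real (Suc K)) * M (n + j) * h ^ j / fact j
       \<le> exp (real (n + j) - real (Suc K)) * (\<mu> ^ j * M n) * h ^ j / fact j"
      using h by (intro divide_right_mono mult_right_mono mult_left_mono) auto
    also have exp_split: "exp (real (n + j) - real (Suc K)) = exp (real n - real (Suc K)) * exp 1 ^ j"
      by (simp add: exp_add[symmetric] exp_of_nat_mult[symmetric])
    also have "exp (real n - real (Suc K)) * exp 1 ^ j * (\<mu> ^ j * M n) * h ^ j / fact j
        = exp (real n - real (Suc K)) * M n * ((exp 1 * h * \<mu>) ^ j / fact j)"
      by (simp add: power_mult_distrib)
    finally show ?thesis by (simp only: exp_split)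
  qed
  have "\<bar>f n (t + h)\<bar> \<le> \<bar>\<Sum>j<m. f (n + j) t * h ^ j / fact j\<bar> + M (n + m) * h ^ m / fact m"
    using taylor[of n t h m] h by simp
  also have "\<bar>\<Sum>j<m. f (n + j) t * h ^ j / fact j\<bar> 
      \<le> (\<Sum>j<m. exp (real (n + j) - real (Suc K)) * M (n + j) * h ^ j / fact j)"
    using level[of "n + j" for j] h
    by (intro order_trans[OF sum_abs] sum_mono) 
       (auto simp: abs_mult intro!: divide_right_mono mult_right_mono)
  also have "M (n + m) * h ^ m / fact m
      = exp (real (n + m) - real (Suc K)) * M (n + m) * h ^ m / fact m"
    unfolding nm by simp
  also have "(\<Sum>j<m. exp (real (n + j) - real (Suc K)) * M (n + j) * h ^ j / fact j) + \<dots>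
      = (\<Sum>j\<le>m. exp (real (n + j) - real (Suc K)) * M (n + j) * h ^ j / fact j)"
    by (simp add: lessThan_Suc_atMost[symmetric])
  also have "\<dots> \<le> (\<Sum>j\<le>m. exp (real n - real (Suc K)) * M n * ((exp 1 * h * \<mu>) ^ j / fact j))"
    by (intro sum_mono summand) simp
  also have "\<dots> = exp (real n - real (Suc K)) * M n * (\<Sum>j\<le>m. (exp 1 * h * \<mu>) ^ j / fact j)"
    by (simp add: sum_distrib_left)
  also have "(\<Sum>j\<le>m. (exp 1 * h * \<mu>) ^ j / fact j) \<le> exp (exp 1 * h * \<mu>)"
  proof -
    have "(\<Sum>j\<le>m. x ^ j / fact j) \<le> exp x" if "x \<ge> 0" for x :: real
      using sum_le_suminf[OF sums_summable[OF exp_converges[of x]], of "{..m}"] that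
        sums_unique[OF exp_converges[of x]]
      by (simp add: divide_inverse mult.commute)
    then show ?thesis using h \<mu> by simp
  qed
  also have "exp (exp 1 * h * \<mu>) \<le> exp 1" using \<mu> by simp
  also have "exp (real n - real (Suc K)) * M n * exp 1 = exp (real n - real K) * M n"
    by (simp add: exp_diff exp_add field_simps)
  finally show ?thesis using pos[of n] by (simp add: mult_left_mono less_imp_le)
qed

text \<open>
The Denjoy-Carleman theorem on a half line. At \<open>0\<close> every flatness level is available. Starting from level
\<open>K + N\<close> and giving up one level per step, level \<open>K\<close> survives up to the sum of the step lengths
\<open>M i / (e * M (Suc i))\<close> for \<open>K \<le> i < K + N\<close>, which is arbitrarily large by divergence. Hence every point
has every level.
\<close>

lemma quasianalytic_vanishing:
  fixes f :: "nat \<Rightarrow> real \<Rightarrow> real" and M :: "nat \<Rightarrow> real"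
  assumes pos: "\<And>n. M n > 0"
    and convex: "\<And>n. M (Suc n) ^ 2 \<le> M n * M (Suc (Suc n))"
    and divergence: "\<not> summable (\<lambda>n. M n / M (Suc n))"
    and taylor: "\<And>n m t h. \<bar>f n (t + h) - (\<Sum>j<m. f (n + j) t * h ^ j / fact j)\<bar>
                   \<le> M (n + m) * \<bar>h\<bar> ^ m / fact m"
    and flat: "\<And>n. f n 0 = 0"
    and "0 \<le> t"
  shows "f n t = 0"
proof -
  define \<delta> where "\<delta> i = M i / M (Suc i) / exp 1" for i
  have \<delta>_pos: "\<delta> i > 0" for i using pos by (simp add: \<delta>_def)
  have level: "\<bar>f n t\<bar> \<le> exp (real n - real K) * M n"
    if "0 \<le> t" "t \<le> (\<Sum>i<N. \<delta> (K + i))" for N K t n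
    using that
  proof (induction N arbitrary: K t n)
    case 0
    then show ?case using flat[of n] pos[of n] by simp
  next
    case (Suc N)
    define t' where "t' = max 0 (t - \<delta> K)"
    have "(\<Sum>i<Suc N. \<delta> (K + i)) = \<delta> K + (\<Sum>i<N. \<delta> (Suc K + i))"
      by (simp add: sum.lessThan_Suc_shift del: sum.lessThan_Suc)
    moreover have "(\<Sum>i<N. \<delta> (Suc K + i)) \<ge> 0"
      using \<delta>_pos by (intro sum_nonneg) (auto intro: less_imp_le)
    ultimately have t': "0 \<le> t'" "t' \<le> (\<Sum>i<N. \<delta> (Suc K + i))" "t' \<le> t" "t - t' \<le> \<delta> K"
      using Suc.prems \<delta>_pos[of K] by (auto simp: t'_def)
    have "\<bar>f n (t' + (t - t'))\<bar> \<le> exp (real n - real K) * M n"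
    proof (rule quasianalytic_step[of M f, OF pos convex taylor])
      show "\<bar>f n t'\<bar> \<le> exp (real n - real (Suc K)) * M n" for n
        by (rule Suc.IH[OF t'(1,2)])
      have "exp 1 * (t - t') \<le> exp 1 * \<delta> K"
        using t' by (intro mult_left_mono) auto
      then show "exp 1 * (t - t') \<le> M K / M (Suc K)"
        by (simp add: \<delta>_def)
    qed (use t' in auto)
    then show ?case by simp
  qed
  have "\<exists>N. t \<le> (\<Sum>i<N. \<delta> (K + i))" for K
  proof (rule ccontr)
    assume "\<not> ?thesis"
    then have "\<And>N. (\<Sum>i<N. \<delta> (i + K)) \<le> t"
      by (force simp: not_le add.commute intro: less_imp_le)
    with \<delta>_pos have "summable (\<lambda>i. \<delta> (i + K))"
      by (intro summableI_nonneg_bounded) (auto intro: less_imp_le)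
    then have "summable (\<lambda>i. exp 1 * \<delta> i)"
      unfolding summable_iff_shift by (rule summable_mult)
    with divergence show False by (simp add: \<delta>_def)
  qed
  then have "\<bar>f n t\<bar> \<le> exp (real n - real K) * M n" for K
    using level[OF \<open>0 \<le> t\<close>] by blast
  moreover have "(\<lambda>K. exp (real n - real K) * M n) \<longlonglongrightarrow> 0"
    by real_asymp
  ultimately have "\<bar>f n t\<bar> \<le> 0"
    by (intro LIMSEQ_le_const) auto
  then show ?thesis by simp
qed

section \<open>Carleman's criterion on the half line\<close>

text \<open>
The \<open>n\<close>-th derivative of the cosine transform \<open>t \<mapsto> \<integral> cos (t * x) dE\<close>, written as an integral.
\<close>

definition moment_fourier :: "real measure \<Rightarrow> nat \<Rightarrow> real \<Rightarrow> real" where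
  "moment_fourier E n t = (\<integral>x. Re ((\<i> * complex_of_real x) ^ n * iexp (t * x)) \<partial>E)"

lemma integrable_moment_fourier:
  assumes "real_distribution E" and "\<And>n::nat. integrable E (\<lambda>x. x ^ n)"
  shows "integrable E (\<lambda>x. Re ((\<i> * complex_of_real x) ^ n * iexp (t * x)))"
proof (rule Bochner_Integration.integrable_bound)
  interpret real_distribution E by fact
  show "integrable E (\<lambda>x. x ^ n)" by (rule assms)
  have "\<bar>Re ((\<i> * complex_of_real x) ^ n * iexp (t * x))\<bar> \<le> \<bar>x ^ n\<bar>" for x
    using abs_Re_le_cmod[of "(\<i> * complex_of_real x) ^ n * iexp (t * x)"]
    by (simp add: norm_mult norm_power power_abs)
  then show "AE x in E. norm (Re ((\<i> * complex_of_real x) ^ n * iexp (t * x))) \<le> norm (x ^ n)"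
    by simp
  show "(\<lambda>x. Re ((\<i> * complex_of_real x) ^ n * iexp (t * x))) \<in> borel_measurable E"
    by measurable
qed

text \<open>
The bound \<open>\<bar>h * x\<bar> ^ m / m!\<close> for the remainder of the exponential series, integrated against \<open>(\<i> * x) ^ n\<close> times
the oscillating factor.
\<close>

lemma moment_fourier_taylor:
  assumes "real_distribution E" and "\<And>n::nat. integrable E (\<lambda>x. x ^ n)"
  shows "\<bar>moment_fourier E n (t + h) - (\<Sum>j<m. moment_fourier E (n + j) t * h ^ j / fact j)\<bar>
           \<le> (\<integral>x. \<bar>x\<bar> ^ (n + m) \<partial>E) * \<bar>h\<bar> ^ m / fact m"
proof -
  interpret real_distribution E by fact
  define c where "c k s x = Re ((\<i> * complex_of_real x) ^ k * iexp (s * x))" for k s x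
  have int: "integrable E (c k s)" for k s
    unfolding c_def by (rule integrable_moment_fourier[OF assms])
  have moment_int: "moment_fourier E k s = (\<integral>x. c k s x \<partial>E)" for k s
    by (simp add: moment_fourier_def c_def)
  have int_abs: "integrable E (\<lambda>x. \<bar>x\<bar> ^ k)" for k
    using integrable_abs[OF assms(2)[of k]] by (simp add: power_abs)
  have exp_rem: "cmod (iexp x - (\<Sum>j<m. (\<i> * complex_of_real x) ^ j / fact j)) \<le> \<bar>x\<bar> ^ m / fact m" for x
    using iexp_approx1[of x "m - 1"] by (cases m) (simp_all add: lessThan_Suc_atMost)
  have pointwise: "\<bar>c n (t + h) x - (\<Sum>j<m. c (n + j) t x * h ^ j / fact j)\<bar>
      \<le> \<bar>x\<bar> ^ (n + m) * \<bar>h\<bar> ^ m / fact m" for x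
  proof -
    define z where "z = (\<i> * complex_of_real x) ^ n * iexp (t * x)"
    have "c n (t + h) x = Re (z * iexp (h * x))"
      by (simp add: c_def z_def exp_add[symmetric] algebra_simps)
    moreover have "c (n + j) t x * h ^ j / fact j = Re (z * ((\<i> * complex_of_real (h * x)) ^ j / fact j))" for j
    proof -
      have "z * ((\<i> * complex_of_real (h * x)) ^ j / fact j)
          = (\<i> * complex_of_real x) ^ (n + j) * iexp (t * x) * complex_of_real (h ^ j / fact j)"
        by (simp add: z_def power_mult_distrib power_add)
      then show ?thesis by (simp only: Re_complex_of_real times_complex.sel Im_complex_of_real c_def) simp
    qed
    ultimately have "c n (t + h) x - (\<Sum>j<m. c (n + j) t x * h ^ j / fact j)
        = Re (z * (iexp (h * x) - (\<Sum>j<m. (\<i> * complex_of_real (h * x)) ^ j / fact j)))"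
      by (simp only: right_diff_distrib minus_complex.sel sum_distrib_left Re_sum)
    also have "\<bar>\<dots>\<bar> \<le> cmod z * cmod (iexp (h * x) - (\<Sum>j<m. (\<i> * complex_of_real (h * x)) ^ j / fact j))"
      by (metis abs_Re_le_cmod norm_mult)
    also have "\<dots> \<le> \<bar>x\<bar> ^ n * (\<bar>h * x\<bar> ^ m / fact m)"
      by (intro mult_mono exp_rem) (auto simp: z_def norm_mult norm_power)
    finally show ?thesis by (simp add: abs_mult power_mult_distrib power_add mult_ac)
  qed
  have "moment_fourier E n (t + h) - (\<Sum>j<m. moment_fourier E (n + j) t * h ^ j / fact j)
      = (\<integral>x. c n (t + h) x - (\<Sum>j<m. c (n + j) t x * h ^ j / fact j) \<partial>E)"
    unfolding moment_int using int by simp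
  also have "\<bar>\<dots>\<bar> \<le> (\<integral>x. \<bar>c n (t + h) x - (\<Sum>j<m. c (n + j) t x * h ^ j / fact j)\<bar> \<partial>E)"
    using integral_norm_bound[of E "\<lambda>x. c n (t + h) x - (\<Sum>j<m. c (n + j) t x * h ^ j / fact j)"]
    by simp
  also have "\<dots> \<le> (\<integral>x. \<bar>x\<bar> ^ (n + m) * \<bar>h\<bar> ^ m / fact m \<partial>E)"
    using int int_abs by (intro integral_mono pointwise) auto
  finally show ?thesis by simp
qed

text \<open>
At the origin only even moments survive, because \<open>Re (\<i> ^ n)\<close> vanishes for odd \<open>n\<close>. This is why the
cosine transform is used and not the characteristic function: the odd moments of the square root of a
variable are not moments of that variable.
\<close>

lemma moment_fourier_0:
  "moment_fourier E n 0 = Re (\<i> ^ n) * (\<integral>x. x ^ n \<partial>E)"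
proof -
  have "Re ((\<i> * complex_of_real x) ^ n) = Re (\<i> ^ n) * x ^ n" for x
    by (simp add: power_mult_distrib flip: of_real_power)
  then show ?thesis by (simp add: moment_fourier_def)
qed

text \<open>
Multiply the variable by an independent fair sign. The cosine transform is the characteristic function of
the resulting symmetric law, so Levy's uniqueness theorem applies to it, and the absolute value recovers
the original nonnegative variable.
\<close>

lemma nonneg_law_determined_by_cosine_transform:
  assumes E: "real_distribution E" "AE x in E. 0 \<le> x"
    and E': "real_distribution E'" "AE x in E'. 0 \<le> x"
    and eq: "\<And>t. (\<integral>x. cos (t * x) \<partial>E) = (\<integral>x. cos (t * x) \<partial>E')"
  shows "E = E'"
proof -
  define coin where "coin = measure_pmf (pmf_of_set {1, -1 :: real})"
  interpret C: prob_space coin by (simp add: coin_def prob_space_measure_pmf)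
  define symm where "symm D = distr (D \<Otimes>\<^sub>M coin) borel (\<lambda>p. snd p * fst p)" for D :: "real measure"
  have [measurable]: "snd \<in> borel_measurable (D \<Otimes>\<^sub>M coin)" for D :: "real measure"
    by (rule measurable_compose[OF measurable_snd]) (simp add: coin_def)
  have meas: "(\<lambda>p. snd p * fst p) \<in> borel_measurable (D \<Otimes>\<^sub>M coin)"
    if "real_distribution D" for D
  proof -
    interpret real_distribution D by fact
    show ?thesis by measurable
  qed
  have symm_dist: "real_distribution (symm D)" if "real_distribution D" for D
  proof -
    interpret real_distribution D by fact
    interpret P: pair_prob_space D coin ..
    show ?thesis unfolding symm_def using meas[OF that] by (intro P.real_distribution_distr)
  qed
  have char_symm: "char (symm D) t = complex_of_real (\<integral>x. cos (t * x) \<partial>D)"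
    if "real_distribution D" for D t
  proof -
    interpret real_distribution D by fact
    interpret P: pair_prob_space D coin ..
    note [measurable] = meas[OF that]
    have "char (symm D) t = (\<integral>p. iexp (t * (snd p * fst p)) \<partial>(D \<Otimes>\<^sub>M coin))"
      unfolding char_def symm_def by (subst integral_distr) simp_all
    also have "\<dots> = (\<integral>x. (\<integral>s. iexp (t * (s * x)) \<partial>coin) \<partial>D)"
      by (subst P.integral_fst'[symmetric]) 
         (auto intro!: P.integrable_const_bound[of _ 1])
    also have "(\<lambda>x. (\<integral>s. iexp (t * (s * x)) \<partial>coin)) = (\<lambda>x. complex_of_real (cos (t * x)))"
    proof
      fix x
      have "(\<integral>s. iexp (t * (s * x)) \<partial>coin) = (\<Sum>s\<in>{1, -1}. pmf (pmf_of_set {1, -1 :: real}) s *\<^sub>R iexp (t * (s * x)))"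
        unfolding coin_def by (rule integral_measure_pmf) simp_all
      also have "\<dots> = (iexp (t * x) + iexp (- (t * x))) / 2"
        by (simp add: scaleR_conv_of_real add_divide_distrib)
      also have "\<dots> = complex_of_real (cos (t * x))"
        by (simp add: cos_exp_eq flip: cos_of_real)
      finally show "(\<integral>s. iexp (t * (s * x)) \<partial>coin) = complex_of_real (cos (t * x))" .
    qed
    finally show ?thesis by simp
  qed
  have abs_symm: "distr (symm D) borel abs = D" if "real_distribution D" "AE x in D. 0 \<le> x" for D
  proof -
    interpret real_distribution D by fact
    interpret P: pair_prob_space D coin ..
    note [measurable] = meas[OF that(1)]
    have fst_nonneg: "AE p in D \<Otimes>\<^sub>M coin. 0 \<le> fst p"
    proof (subst P.AE_pair_iff[symmetric])
      show "{p \<in> space (D \<Otimes>\<^sub>M coin). 0 \<le> fst p} \<in> sets (D \<Otimes>\<^sub>M coin)"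
        by measurable
      show "AE x in D. AE s in coin. 0 \<le> x"
        using that(2) by auto
    qed
    have snd_unit: "AE p in D \<Otimes>\<^sub>M coin. \<bar>snd p\<bar> = 1"
    proof -
      have "AE s in coin. \<bar>s\<bar> = 1"
        unfolding coin_def by (subst AE_measure_pmf_iff) auto
      then have "AE x in D. AE s in coin. \<bar>s\<bar> = 1"
        by simp
      moreover have "{p \<in> space (D \<Otimes>\<^sub>M coin). \<bar>snd p\<bar> = 1} \<in> sets (D \<Otimes>\<^sub>M coin)"
      proof -
        have "{p \<in> space (D \<Otimes>\<^sub>M coin). \<bar>snd p\<bar> = 1}
            = snd -` {s. \<bar>s\<bar> = 1} \<inter> space (D \<Otimes>\<^sub>M coin)"
          by blast
        moreover have "{s. \<bar>s\<bar> = 1} \<in> sets coin"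
          unfolding coin_def by simp
        ultimately show ?thesis
          using measurable_sets[OF measurable_snd] by metis
      qed
      ultimately show ?thesis
        using P.AE_pair_iff[where P = "\<lambda>x s. \<bar>s\<bar> = 1"] by blast
    qed
    have "distr (symm D) borel abs = distr (D \<Otimes>\<^sub>M coin) borel (\<lambda>p. \<bar>snd p * fst p\<bar>)"
      unfolding symm_def by (subst distr_distr) (auto simp: comp_def)
    also have "\<dots> = distr (D \<Otimes>\<^sub>M coin) D fst"
    proof (rule distr_cong_AE)
      show "AE p in D \<Otimes>\<^sub>M coin. \<bar>snd p * fst p\<bar> = fst p"
        using fst_nonneg snd_unit by eventually_elim (simp add: abs_mult)
    qed auto
    also have "\<dots> = D" by (rule C.distr_pair_fst)
    finally show ?thesis .
  qed
  have "symm E = symm E'"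
    using E E' eq by (intro Levy_uniqueness symm_dist) (auto simp: char_symm)
  then show "E = E'"
    using abs_symm[OF E] abs_symm[OF E'] by metis
qed

text \<open>
The difference of the two cosine transforms has all derivatives zero at the origin, and its \<open>n\<close>-th
derivative is bounded by the sum \<open>M n\<close> of the two absolute moments. The odd moments of the two laws may
differ a priori, hence the sum. It is the moment sequence of the measure sum of the two laws, so it is
log-convex, and its even terms are twice the common even moments.
\<close>

lemma nonneg_law_determined_by_even_moments:
  assumes E: "nonneg_distribution_finite_moments E"
    and E': "nonneg_distribution_finite_moments E'"
    and even_moments: "\<And>n. (\<integral>x. x ^ (2 * n) \<partial>E) = (\<integral>x. x ^ (2 * n) \<partial>E')"
    and divergence: "\<not> summable (\<lambda>n. (\<integral>x. x ^ (2 * Suc n) \<partial>E) powr (- 1 / (2 * real (Suc n))))"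
  shows "E = E'"
proof -
  interpret E: real_distribution E using E by (simp add: nonneg_distribution_finite_moments_def)
  interpret E': real_distribution E' using E' by (simp add: nonneg_distribution_finite_moments_def)
  have nonneg: "AE x in E. 0 \<le> x" "AE x in E'. 0 \<le> x"
    using E E' by (simp_all add: nonneg_distribution_finite_moments_def)
  have int: "integrable E (\<lambda>x. x ^ n)" "integrable E' (\<lambda>x. x ^ n)" for n :: nat
    using E E' by (cases n; auto simp: nonneg_distribution_finite_moments_def)+
  define M where "M n = (\<integral>x. x ^ n \<partial>E) + (\<integral>x. x ^ n \<partial>E')" for n :: nat
  have moment_nonneg: "(\<integral>x. x ^ n \<partial>E) \<ge> 0" "(\<integral>x. x ^ n \<partial>E') \<ge> 0" for n :: nat
    using nonneg by (auto intro!: integral_nonneg_AE)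
  have M_abs: "M n = (\<integral>x. \<bar>x\<bar> ^ n \<partial>E) + (\<integral>x. \<bar>x\<bar> ^ n \<partial>E')" for n
    unfolding M_def using nonneg by (intro arg_cong2[of _ _ _ _ "(+)"] integral_cong_AE) auto
  \<comment> \<open>A vanishing moment would concentrate the law at 0 and make the divergent series a series of zeros.\<close>
  have moment_pos: "(\<integral>x. x ^ n \<partial>E) > 0" for n :: nat
  proof (rule ccontr)
    assume "\<not> ?thesis"
    then have "(\<integral>x. x ^ n \<partial>E) = 0" using moment_nonneg[of n] by simp
    then have "AE x in E. x ^ n = 0"
      using nonneg int by (subst integral_nonneg_eq_0_iff_AE[symmetric]) auto
    then have "AE x in E. x ^ (2 * Suc k) = 0" for k
      by eventually_elim auto
    then have "(\<integral>x. x ^ (2 * Suc k) \<partial>E) = 0" for k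
      by (rule integral_eq_zero_AE)
    then show False using divergence by simp
  qed
  have M_pos: "M n > 0" for n
    unfolding M_def using moment_pos[of n] moment_nonneg(2)[of n] by simp
  have convex: "M (Suc n) ^ 2 \<le> M n * M (Suc (Suc n))" for n
  proof -
    \<comment> \<open>The discriminant argument behind Cauchy-Schwarz, at the minimising \<open>r\<close>.\<close>
    define r where "r = M (Suc n) / M n"
    have expand: "x ^ n * (x - r) ^ 2 = x ^ Suc (Suc n) - 2 * r * x ^ Suc n + r ^ 2 * x ^ n" for x :: real
      by (simp add: power2_eq_square algebra_simps)
    have "0 \<le> (\<integral>x. x ^ n * (x - r) ^ 2 \<partial>E) + (\<integral>x. x ^ n * (x - r) ^ 2 \<partial>E')"
      using nonneg by (intro add_nonneg_nonneg integral_nonneg_AE) auto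
    also have "\<dots> = M (Suc (Suc n)) - 2 * r * M (Suc n) + r ^ 2 * M n"
      unfolding expand M_def using int[of "Suc (Suc n)"] int[of "Suc n"] int[of n]
      by (simp add: algebra_simps del: power_Suc)
    also have "\<dots> = M (Suc (Suc n)) - M (Suc n) ^ 2 / M n"
      using M_pos[of n] by (simp add: r_def field_simps power2_eq_square)
    finally show ?thesis using M_pos[of n] by (simp add: field_simps)
  qed
  have M0: "M 0 = 2" unfolding M_def using E.prob_space E'.prob_space by simp
  have M_even: "M (2 * n) = 2 * (\<integral>x. x ^ (2 * n) \<partial>E)" for n
    unfolding M_def even_moments[symmetric] by simp
  have "\<not> summable (\<lambda>n. (M 0 / M (Suc n)) powr (1 / real (Suc n)))"
  proof
    assume "summable (\<lambda>n. (M 0 / M (Suc n)) powr (1 / real (Suc n)))"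
    \<comment> \<open>Restrict the series to the even orders \<open>Suc n = 2 * Suc k\<close>, where \<open>M\<close> is known.\<close>
    then have "summable ((\<lambda>n. (M 0 / M (Suc n)) powr (1 / real (Suc n))) \<circ> (\<lambda>k. Suc (2 * k)))"
      by (rule summable_reindex) (auto simp: inj_def)
    also have "(\<lambda>n. (M 0 / M (Suc n)) powr (1 / real (Suc n))) \<circ> (\<lambda>k. Suc (2 * k))
        = (\<lambda>k. (\<integral>x. x ^ (2 * Suc k) \<partial>E) powr (- 1 / (2 * real (Suc k))))"
    proof
      fix k
      have "M 0 / M (2 * Suc k) = inverse (\<integral>x. x ^ (2 * Suc k) \<partial>E)"
        unfolding M0 M_even using moment_pos[of "2 * Suc k"] by (simp add: field_simps)
      then have "(M 0 / M (2 * Suc k)) powr (1 / real (2 * Suc k))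
          = (\<integral>x. x ^ (2 * Suc k) \<partial>E) powr (- 1 / (2 * real (Suc k)))"
        using moment_pos[of "2 * Suc k"] by (simp only:) (simp add: powr_def ln_inverse)
      then show "((\<lambda>n. (M 0 / M (Suc n)) powr (1 / real (Suc n))) \<circ> (\<lambda>k. Suc (2 * k))) k
          = (\<integral>x. x ^ (2 * Suc k) \<partial>E) powr (- 1 / (2 * real (Suc k)))" by simp
    qed
    finally show False using divergence by contradiction
  qed
  then have ratio_divergence: "\<not> summable (\<lambda>n. M n / M (Suc n))"
    by (rule geometric_mean_ratio_divergence[OF M_pos])
  define f where "f n t = moment_fourier E n t - moment_fourier E' n t" for n t
  have taylor: "\<bar>f n (t + h) - (\<Sum>j<m. f (n + j) t * h ^ j / fact j)\<bar>
      \<le> M (n + m) * \<bar>h\<bar> ^ m / fact m" for n m t h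
  proof -
    have "f n (t + h) - (\<Sum>j<m. f (n + j) t * h ^ j / fact j)
      = (moment_fourier E n (t + h) - (\<Sum>j<m. moment_fourier E (n + j) t * h ^ j / fact j))
      - (moment_fourier E' n (t + h) - (\<Sum>j<m. moment_fourier E' (n + j) t * h ^ j / fact j))"
      by (simp add: f_def left_diff_distrib diff_divide_distrib sum_subtractf)
    also have "\<bar>\<dots>\<bar> \<le> (\<integral>x. \<bar>x\<bar> ^ (n + m) \<partial>E) * \<bar>h\<bar> ^ m / fact m
        + (\<integral>x. \<bar>x\<bar> ^ (n + m) \<partial>E') * \<bar>h\<bar> ^ m / fact m"
      by (intro order_trans[OF abs_triangle_ineq4] add_mono moment_fourier_taylor int
          E.real_distribution_axioms E'.real_distribution_axioms)
    finally show ?thesis by (simp add: M_abs algebra_simps add_divide_distrib)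
  qed
  have flat: "f n 0 = 0" for n
  proof (cases "even n")
    case True
    then obtain k where "n = 2 * k" by blast
    then show ?thesis using even_moments[of k] by (simp add: f_def moment_fourier_0)
  next
    case False
    then obtain k where "n = 2 * k + 1" by (blast elim: oddE)
    then show ?thesis by (simp add: f_def moment_fourier_0 power_mult)
  qed
  have "f 0 t = 0" if "t \<ge> 0" for t
    by (rule quasianalytic_vanishing[of M f, OF M_pos convex ratio_divergence taylor flat that])
  then have cos_pos: "(\<integral>x. cos (t * x) \<partial>E) = (\<integral>x. cos (t * x) \<partial>E')" if "t \<ge> 0" for t
    using that by (simp add: f_def moment_fourier_def Re_exp)
  have "(\<integral>x. cos (t * x) \<partial>E) = (\<integral>x. cos (t * x) \<partial>E')" for t
    using cos_pos[of "\<bar>t\<bar>"] by (cases "t \<ge> 0") simp_all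
  then show ?thesis
    using nonneg by (intro nonneg_law_determined_by_cosine_transform
        E.real_distribution_axioms E'.real_distribution_axioms)
qed

text \<open>
Carleman's criterion on the half line. Taking square roots turns the moments of a law into the even
moments of its root law, and the exponents \<open>1 / (2 * n)\<close> in Carleman's condition into the \<open>2 * n\<close>-th roots
of these even moments.
\<close>

theorem carleman_imp_moment_determinate_nonneg:
  assumes D: "nonneg_distribution_finite_moments D"
    and carleman: "carleman_condition_nonneg D (\<lambda>x. x)"
  shows "moment_determinate_nonneg D"
  unfolding moment_determinate_nonneg_def
proof (intro conjI allI impI)
  show "nonneg_distribution_finite_moments D" by fact
next
  fix D' assume D': "nonneg_distribution_finite_moments D'"
    and moments: "\<forall>n\<ge>1. (\<integral>x. x ^ n \<partial>D') = (\<integral>x. x ^ n \<partial>D)"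
  define root_law where "root_law D = distr D borel sqrt" for D :: "real measure"
  have root_moment: "nonneg_distribution_finite_moments (root_law D)"
    "(\<integral>x. x ^ (2 * n) \<partial>root_law D) = (\<integral>x. x ^ n \<partial>D)"
    "distr (root_law D) borel (\<lambda>x. x ^ 2) = D"
    if "nonneg_distribution_finite_moments D" for D and n :: nat
  proof -
    interpret real_distribution D using that by (simp add: nonneg_distribution_finite_moments_def)
    have nonneg: "AE x in D. 0 \<le> x" and int: "\<And>n. n \<ge> 1 \<Longrightarrow> integrable D (\<lambda>x. x ^ n)"
      using that by (simp_all add: nonneg_distribution_finite_moments_def)
    have "integrable D (\<lambda>x. sqrt x ^ n)" if "n \<ge> 1" for n
    proof (rule Bochner_Integration.integrable_bound)
      show "integrable D (\<lambda>x. 1 + x ^ n)" using int[OF that] by simp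
      have "norm (sqrt x ^ n) \<le> norm (1 + x ^ n)" if "0 \<le> x" for x
      proof (cases "x \<le> 1")
        case True
        then have "sqrt x ^ n \<le> 1" using that by (intro power_le_one) auto
        also have "1 \<le> norm (1 + x ^ n)" using that by simp
        finally show ?thesis using that by simp
      next
        case False
        then have "sqrt x \<le> x" using real_sqrt_le_iff[of x "x\<^sup>2"] by (simp add: power2_eq_square)
        then have "sqrt x ^ n \<le> x ^ n" using that by (intro power_mono) auto
        then show ?thesis using that by simp
      qed
      then show "AE x in D. norm (sqrt x ^ n) \<le> norm (1 + x ^ n)"
        using nonneg by auto
    qed simp
    then show "nonneg_distribution_finite_moments (root_law D)"
      using nonneg unfolding nonneg_distribution_finite_moments_def root_law_def
      by (auto simp: AE_distr_iff integrable_distr_eq intro: real_distribution_distr)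
    have "(\<integral>x. x ^ (2 * n) \<partial>root_law D) = (\<integral>x. sqrt x ^ (2 * n) \<partial>D)"
      unfolding root_law_def by (subst integral_distr) auto
    also have "\<dots> = (\<integral>x. x ^ n \<partial>D)"
      using nonneg by (intro integral_cong_AE) (auto simp: power_mult)
    finally show "(\<integral>x. x ^ (2 * n) \<partial>root_law D) = (\<integral>x. x ^ n \<partial>D)" .
    have "distr (root_law D) borel (\<lambda>x. x ^ 2) = distr D borel (\<lambda>x. sqrt x ^ 2)"
      unfolding root_law_def by (subst distr_distr) (auto simp: comp_def)
    also have "\<dots> = distr D D (\<lambda>x. x)"
      using nonneg by (intro distr_cong_AE) auto
    finally show "distr (root_law D) borel (\<lambda>x. x ^ 2) = D" by simp
  qed
  have "root_law D = root_law D'"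
  proof (rule nonneg_law_determined_by_even_moments)
    show "nonneg_distribution_finite_moments (root_law D)"
      "nonneg_distribution_finite_moments (root_law D')"
      using root_moment D D' by blast+
    interpret D: real_distribution D using D by (simp add: nonneg_distribution_finite_moments_def)
    interpret D': real_distribution D' using D' by (simp add: nonneg_distribution_finite_moments_def)
    have "(\<integral>x. x ^ n \<partial>D) = (\<integral>x. x ^ n \<partial>D')" for n
    proof (cases "n = 0")
      case True
      then show ?thesis using D.prob_space D'.prob_space by simp
    next
      case False
      then show ?thesis using moments by (metis One_nat_def Suc_leI neq0_conv)
    qed
    then show "(\<integral>x. x ^ (2 * n) \<partial>root_law D) = (\<integral>x. x ^ (2 * n) \<partial>root_law D')" for n
      by (simp only: root_moment(2)[OF D] root_moment(2)[OF D'])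
    show "\<not> summable (\<lambda>n. (\<integral>x. x ^ (2 * Suc n) \<partial>root_law D) powr (- 1 / (2 * real (Suc n))))"
      unfolding root_moment(2)[OF D]
    proof
      assume "summable (\<lambda>n. (\<integral>x. x ^ Suc n \<partial>D) powr (- 1 / (2 * real (Suc n))))"
      then have "(\<Sum>n. ennreal ((\<integral>x. x ^ Suc n \<partial>D) powr (- 1 / (2 * real (Suc n))))) \<noteq> \<infinity>"
        by (subst suminf_ennreal2) auto
      then show False using carleman by (simp add: carleman_condition_nonneg_def)
    qed
  qed
  then show "D' = D"
    using root_moment(3)[OF D] root_moment(3)[OF D'] by metis
qed

section \<open>Carleman's series for moments of nearly critical size\<close>

lemma not_summable_inverse_n_ln:
  "\<not> summable (\<lambda>n. 1 / (real (Suc n) * ln (real (Suc n) + 2)))"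
proof
  define f where "f n = 1 / (real n * ln (real n + 2))" for n :: nat
  assume "summable (\<lambda>n. 1 / (real (Suc n) * ln (real (Suc n) + 2)))"
  then have "summable f"
    unfolding summable_Suc_iff[of f, symmetric] f_def .
  also have "summable f \<longleftrightarrow> summable (\<lambda>n. 2 ^ n * f (2 ^ n))"
  proof (rule condensation_test)
    show "f (Suc m) \<le> f m" if "0 < m" for m
      unfolding f_def using that by (intro divide_left_mono mult_mono mult_pos_pos ln_mono) auto
    show "f n \<ge> 0" for n by (simp add: f_def)
  qed
  finally have "summable (\<lambda>n. 2 ^ n * f (2 ^ n))" .
  then have "summable (\<lambda>n. 1 / (real (n + 2) * ln 2))"
  proof (rule summable_comparison_test'[where N = 0])
    fix n :: nat
    have "ln (2 ^ n + 2 :: real) \<le> ln (2 ^ (n + 2))"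
    proof (subst ln_le_cancel_iff)
      show "(0::real) < 2 ^ n + 2" by (intro add_pos_pos) auto
      show "2 ^ n + 2 \<le> (2 ^ (n + 2) :: real)"
      proof -
        have "1 \<le> (2 :: real) ^ n" by simp
        moreover have "(2 :: real) ^ (n + 2) = 4 * 2 ^ n" by simp
        ultimately show ?thesis by linarith
      qed
    qed simp
    also have "\<dots> = real (n + 2) * ln 2" by (simp add: ln_realpow del: power_Suc)
    finally have "1 / (real (n + 2) * ln 2) \<le> 1 / ln (2 ^ n + 2)"
    proof (intro divide_left_mono mult_pos_pos)
      have "1 \<le> (2 :: real) ^ n" by simp
      then show "0 < ln (2 ^ n + 2 :: real)" by (intro ln_gt_zero) linarith
    qed auto
    then show "norm (1 / (real (n + 2) * ln 2)) \<le> 2 ^ n * f (2 ^ n)"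
      by (simp add: f_def)
  qed
  then have "summable (\<lambda>n. ln 2 * (1 / (real (n + 2) * ln 2)))" by (rule summable_mult)
  moreover have "ln 2 * (1 / (real (n + 2) * ln 2)) = inverse (real (n + 2))" for n
    by (simp add: inverse_eq_divide)
  ultimately have "summable (\<lambda>n. inverse (real (n + 2)))" by simp
  then show False
    using not_summable_harmonic[where ?'a = real] summable_iff_shift[of "\<lambda>n. inverse (real n)" 2] by simp
qed

text \<open>
This determines the threshold beyond which a shift by a multiple of \<open>ln x\<close> changes \<open>x ^ n\<close> only by a
factor close to 1. With \<open>x = n * u\<close> the claim becomes \<open>ln n + ln u \<le> \<kappa> * u\<close>, and each of the two
logarithms is at most half of the right side once \<open>u\<close> is a large multiple of \<open>ln (n + 2)\<close>.
\<close>

lemma ln_le_linear_beyond_n_ln: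
  fixes \<kappa> :: real
  assumes "\<kappa> > 0"
  obtains K where "K \<ge> 1"
    "\<And>n x. n \<ge> (1::nat) \<Longrightarrow> x \<ge> K * real n * ln (real n + 2) \<Longrightarrow> real n * ln x \<le> \<kappa> * x"
proof -
  have "eventually (\<lambda>u. ln u \<le> \<kappa> / 2 * u) at_top"
    using assms by real_asymp
  then obtain U where U: "\<And>u. u \<ge> U \<Longrightarrow> ln u \<le> \<kappa> / 2 * u"
    by (auto simp: eventually_at_top_linorder)
  define K where "K = Max {1, U, 2 / \<kappa>}"
  have K: "K \<ge> 1" "K \<ge> U" "K \<ge> 2 / \<kappa>" by (simp_all add: K_def)
  have "real n * ln x \<le> \<kappa> * x" if n: "n \<ge> 1" and x: "x \<ge> K * real n * ln (real n + 2)" for n x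
  proof -
    define u where "u = x / real n"
    have "exp 1 \<le> real n + 2" using exp_le n by linarith
    then have ln1: "ln (real n + 2) \<ge> 1" by (simp add: ln_ge_iff)
    have u: "u \<ge> K * ln (real n + 2)" using n x by (simp add: u_def field_simps)
    have "u \<ge> K" using order_trans[OF mult_left_mono[OF ln1, of K] u] K by simp
    have "ln (real n) \<le> ln (real n + 2)" using n by simp
    also have "\<dots> \<le> \<kappa> / 2 * (K * ln (real n + 2))"
    proof -
      have "1 \<le> \<kappa> / 2 * K" using K assms by (simp add: field_simps)
      from mult_right_mono[OF this, of "ln (real n + 2)"] ln1 show ?thesis by (simp add: mult.assoc)
    qed
    also have "\<dots> \<le> \<kappa> / 2 * u" using u assms by (intro mult_left_mono) auto
    finally have "ln (real n) + ln u \<le> \<kappa> * u" using U[of u] \<open>u \<ge> K\<close> K by simp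
    moreover have "ln x = ln (real n) + ln u"
    proof -
      have "x = real n * u" using n by (simp add: u_def)
      then show ?thesis using n \<open>u \<ge> K\<close> K by (simp add: ln_mult)
    qed
    ultimately have "real n * ln x \<le> real n * (\<kappa> * u)" by (intro mult_left_mono) auto
    then show ?thesis using n by (simp add: u_def)
  qed
  with K(1) show ?thesis by (rule that)
qed

text \<open>
Moments of size \<open>(A * n * ln n) ^ (2 * n)\<close> are just small enough: Carleman's series dominates the
divergent series of the terms \<open>1 / (n * ln n)\<close>. The shift \<open>n + 2\<close> under the logarithm only keeps it
positive.
\<close>

lemma carleman_condition_if_moment_growth:
  fixes M :: "'a measure" and Y :: "'a \<Rightarrow> real"
  assumes pos: "\<And>n::nat. n \<ge> 1 \<Longrightarrow> 0 < (\<integral>\<omega>. Y \<omega> ^ n \<partial>M)"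
    and growth: "\<And>n::nat. n \<ge> 1 \<Longrightarrow> (\<integral>\<omega>. Y \<omega> ^ n \<partial>M) \<le> (A * (real n * ln (real n + 2))) ^ (2 * n)"
    and "A > 0"
  shows "carleman_condition_nonneg M Y"
proof -
  define b where "b n = real (Suc n) * ln (real (Suc n) + 2)" for n :: nat
  have b_pos: "b n > 0" for n by (simp add: b_def)
  have lower: "1 / A * (1 / b n) \<le> (\<integral>\<omega>. Y \<omega> ^ Suc n \<partial>M) powr (- 1 / (2 * real (Suc n)))" for n
  proof -
    have "1 / A * (1 / b n) = ((A * b n) ^ (2 * Suc n)) powr (- 1 / (2 * real (Suc n)))"
      using \<open>A > 0\<close> b_pos[of n]
      by (simp add: powr_realpow[symmetric] powr_powr powr_minus_divide del: power_Suc mult_Suc_right of_nat_Suc)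
    also have "\<dots> \<le> (\<integral>\<omega>. Y \<omega> ^ Suc n \<partial>M) powr (- 1 / (2 * real (Suc n)))"
      using pos[of "Suc n"] growth[of "Suc n"] by (intro powr_mono2') (auto simp: b_def)
    finally show ?thesis .
  qed
  show ?thesis
    unfolding carleman_condition_nonneg_def
  proof (rule ccontr)
    assume "(\<Sum>n. ennreal ((\<integral>\<omega>. Y \<omega> ^ Suc n \<partial>M) powr (- 1 / (2 * real (Suc n))))) \<noteq> \<infinity>"
    then have "summable (\<lambda>n. (\<integral>\<omega>. Y \<omega> ^ Suc n \<partial>M) powr (- 1 / (2 * real (Suc n))))"
      by (intro summable_suminf_not_top) auto
    then have "summable (\<lambda>n. 1 / A * (1 / b n))"
      by (rule summable_comparison_test'[where N = 0])
         (use lower \<open>A > 0\<close> b_pos in \<open>auto simp: abs_mult less_imp_le\<close>)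
    then have "summable (\<lambda>n. A * (1 / A * (1 / b n)))" by (rule summable_mult)
    then show False using not_summable_inverse_n_ln \<open>A > 0\<close> by (simp add: b_def)
  qed
qed

section \<open>Moment growth from decay of the density\<close>

text \<open>
The hypothesis on the distribution function concerns increments beyond \<open>x0\<close>, that is, half-open
intervals; these generate the Borel sets, so the law restricted to \<open>{x0<..}\<close> has density \<open>g\<close>. The point
\<open>x0\<close> itself is left out because it may carry an atom.
\<close>

lemma density_from_abs_cont_cdf:
  assumes "real_distribution D"
    and abs_cont: "abs_cont_from_with_density (cdf D) x0 g"
    and g_nonneg: "\<And>x. x \<ge> x0 \<Longrightarrow> 0 \<le> g x"
  shows "(\<lambda>x. indicator {x0<..} x * g x) \<in> borel_measurable borel"
    and "density D (indicator {x0<..}) = density lborel (\<lambda>x. ennreal (indicator {x0<..} x * g x))"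
proof -
  interpret real_distribution D by fact
  let ?g = "\<lambda>x. indicator {x0<..} x * g x"
  have int: "set_integrable lborel {x0..x} g" and
    cdf: "cdf D x = cdf D x0 + set_lebesgue_integral lborel {x0..x} g" if "x \<ge> x0" for x
    using abs_cont that unfolding abs_cont_from_with_density_def by blast+
  have int_Ioc: "set_integrable lborel {a<..b} g" if "x0 \<le> a" for a b
    by (rule set_integrable_subset[OF int[of "max x0 b"]]) (use that in auto)
  show meas: "?g \<in> borel_measurable borel"
  proof (rule borel_measurable_LIMSEQ_real)
    show "(\<lambda>n. indicator {x0<..x0 + real n} x * g x) \<longlonglongrightarrow> ?g x" for x
    proof (rule tendsto_eventually)
      obtain N where "x - x0 \<le> real N" using real_arch_simple by blast
      then have "indicator {x0<..x0 + real n} x * g x = ?g x" if "n \<ge> N" for n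
        using that by (auto simp: indicator_def)
      then show "eventually (\<lambda>n. indicator {x0<..x0 + real n} x * g x = ?g x) sequentially"
        by (auto simp: eventually_sequentially)
    qed
    show "(\<lambda>x. indicator {x0<..x0 + real n} x * g x) \<in> borel_measurable borel" for n
      using borel_measurable_integrable[OF int_Ioc[of x0 "x0 + real n", unfolded set_integrable_def]]
      by simp
  qed
  have Ioc: "emeasure D {a<..b} = (\<integral>\<^sup>+x. ennreal (indicator {a<..b} x * g x) \<partial>lborel)"
    if "x0 \<le> a" "a \<le> b" for a b
  proof -
    have "set_lebesgue_integral lborel ({x0..a} \<union> {a<..b}) g
        = set_lebesgue_integral lborel {x0..a} g + set_lebesgue_integral lborel {a<..b} g"
      using that by (intro set_integral_Un int int_Ioc) auto
    moreover have "{x0..a} \<union> {a<..b} = {x0..b}" using that by auto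
    ultimately have "cdf D b - cdf D a = set_lebesgue_integral lborel {a<..b} g"
      using cdf[OF that(1)] cdf[OF order_trans[OF that]] by simp
    then have "emeasure D {a<..b} = ennreal (set_lebesgue_integral lborel {a<..b} g)"
      using that by (simp add: emeasure_Ioc)
    also have "\<dots> = (\<integral>\<^sup>+x. ennreal (indicator {a<..b} x * g x) \<partial>lborel)"
      unfolding set_lebesgue_integral_def real_scaleR_def
      using int_Ioc[OF that(1)] g_nonneg that
      by (intro nn_integral_eq_integral[symmetric]) (auto simp: set_integrable_def indicator_def)
    finally show ?thesis .
  qed
  have restricted: "emeasure (density D (indicator {x0<..})) {a<..b} = emeasure D ({x0<..} \<inter> {a<..b})" for a b
    by (rule emeasure_restricted) auto
  have weighted: "emeasure (density lborel (\<lambda>x. ennreal (?g x))) {a<..b}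
      = (\<integral>\<^sup>+x. ennreal (?g x) * indicator {a<..b} x \<partial>lborel)" for a b
    using meas by (intro emeasure_density) simp_all
  have eq: "emeasure (density D (indicator {x0<..})) {a<..b}
      = emeasure (density lborel (\<lambda>x. ennreal (?g x))) {a<..b}" for a b
  proof (cases "max a x0 \<le> b")
    case True
    have "{x0<..} \<inter> {a<..b} = {max a x0<..b}" by auto
    then have "emeasure (density D (indicator {x0<..})) {a<..b} = emeasure D {max a x0<..b}"
      by (simp only: restricted)
    also have "\<dots> = (\<integral>\<^sup>+x. ennreal (indicator {max a x0<..b} x * g x) \<partial>lborel)"
      using True by (intro Ioc) simp_all
    also have "\<dots> = emeasure (density lborel (\<lambda>x. ennreal (?g x))) {a<..b}"
      unfolding weighted by (rule nn_integral_cong) (simp add: indicator_def)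
    finally show ?thesis .
  next
    case False
    then have empty: "{x0<..} \<inter> {a<..b} = {}" by auto
    then have "ennreal (?g x) * indicator {a<..b} x = 0" for x
      by (auto simp: indicator_def)
    then show ?thesis by (simp only: restricted weighted empty) simp
  qed
  show "density D (indicator {x0<..}) = density lborel (\<lambda>x. ennreal (?g x))"
  proof (rule measure_eqI_generator_eq[where \<Omega> = UNIV and E = "range (\<lambda>(a, b). {a<..b::real})"
        and A = "\<lambda>i. {- real i<..real i}"])
    show "Int_stable (range (\<lambda>(a, b). {a<..b::real}))"
      unfolding Int_stable_def by (auto simp: Int_greaterThanAtMost)
    fix Y assume "Y \<in> range (\<lambda>(a, b). {a<..b::real})"
    then obtain a b where "Y = {a<..b}" by auto
    then show "emeasure (density D (indicator {x0<..})) Y = emeasure (density lborel (\<lambda>x. ennreal (?g x))) Y"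
      by (simp only: eq)
  next
    show "range (\<lambda>i. {- real i<..real i}) \<subseteq> range (\<lambda>(a, b). {a<..b::real})" by auto
    show "(\<Union>i. {- real i<..real i}) = UNIV" by (rule UN_Ioc_eq_UNIV)
    show "emeasure (density D (indicator {x0<..})) {- real i<..real i} \<noteq> \<infinity>" for i
      by (simp only: restricted) simp
  qed (simp_all add: borel_sigma_sets_Ioc)
qed

text \<open>
Substitute \<open>x = S y\<close> in the part of the \<open>n\<close>-th moment beyond \<open>S y1\<close>. The contraction hypothesis bounds the
transformed integrand by \<open>q\<close> times the original one plus a multiple of the density, so the moment \<open>m\<close>
satisfies \<open>m \<le> S y1 ^ n + q * m + K\<close>. Because \<open>m\<close> is finite, this can be solved for \<open>m\<close>. The substitution
rule is for compact intervals, hence the truncation at \<open>S b\<close> and Fatou's lemma at the end.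
\<close>

lemma moment_bound_by_substitution:
  fixes S S' :: "real \<Rightarrow> real"
  assumes D: "real_distribution D" "AE x in D. 0 \<le> x" "integrable D (\<lambda>x. x ^ n)"
    and abs_cont: "abs_cont_from_with_density (cdf D) x0 g"
    and g_pos: "\<And>x. x \<ge> x0 \<Longrightarrow> 0 < g x"
    and y1: "x0 < y1" "0 < y1"
    and S_deriv: "\<And>y. y \<ge> y1 \<Longrightarrow> (S has_real_derivative S' y) (at y)"
    and S'_cont: "continuous_on {y1..} S'"
    and S'_nonneg: "\<And>y. y \<ge> y1 \<Longrightarrow> 0 \<le> S' y"
    and S_ge: "\<And>y. y \<ge> y1 \<Longrightarrow> y \<le> S y"
    and contraction: "\<And>y. y \<ge> y1 \<Longrightarrow> S y ^ n * g (S y) * S' y \<le> (q * y ^ n + K) * g y"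
    and q: "0 \<le> q" "q < 1" and "0 \<le> K"
  shows "(\<integral>x. x ^ n \<partial>D) \<le> (S y1 ^ n + K) / (1 - q)"
proof -
  interpret real_distribution D by fact
  define m where "m = (\<integral>x. x ^ n \<partial>D)"
  have m_nonneg: "0 \<le> m" unfolding m_def using D(2) by (intro integral_nonneg_AE) auto
  have m: "(\<integral>\<^sup>+x. ennreal (x ^ n) \<partial>D) = ennreal m"
    unfolding m_def using D(2) by (intro nn_integral_eq_integral D(3)) auto
  note g0 = density_from_abs_cont_cdf[OF D(1) abs_cont less_imp_le[OF g_pos]]
  define w where "w x = indicator {x0<..} x * g x" for x :: real
  have w_meas [measurable]: "w \<in> borel_measurable borel"
    unfolding w_def by (rule g0(1)) auto
  have w_nonneg: "w x \<ge> 0" for x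
    using g_pos[of x] by (auto simp: w_def indicator_def)
  have transfer: "(\<integral>\<^sup>+x. h x * indicator {x0<..} x \<partial>D) = (\<integral>\<^sup>+x. ennreal (w x) * h x \<partial>lborel)"
    if [measurable]: "h \<in> borel_measurable borel" for h :: "real \<Rightarrow> ennreal"
  proof -
    have "(\<integral>\<^sup>+x. h x * indicator {x0<..} x \<partial>D) = (\<integral>\<^sup>+x. indicator {x0<..} x * h x \<partial>D)"
      by (simp add: mult.commute)
    also have "\<dots> = (\<integral>\<^sup>+x. h x \<partial>density D (indicator {x0<..}))"
      by (rule nn_integral_density[symmetric]) simp_all
    also have "density D (indicator {x0<..}) = density lborel (\<lambda>x. ennreal (w x))"
      unfolding w_def by (rule g0(2)) auto
    also have "(\<integral>\<^sup>+x. h x \<partial>\<dots>) = (\<integral>\<^sup>+x. ennreal (w x) * h x \<partial>lborel)"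
      by (rule nn_integral_density) simp_all
    finally show ?thesis .
  qed
  have piece: "(\<integral>\<^sup>+x. ennreal (x ^ n) * indicator {S y1<..S b} x \<partial>D) \<le> ennreal (q * m + K)"
    if b: "b \<ge> y1" for b
  proof -
    have x0_S: "x0 < S y1" using S_ge[of y1] y1 by simp
    have "(\<integral>\<^sup>+x. ennreal (x ^ n) * indicator {S y1<..S b} x \<partial>D)
        = (\<integral>\<^sup>+x. (ennreal (x ^ n) * indicator {S y1<..S b} x) * indicator {x0<..} x \<partial>D)"
      using x0_S by (intro nn_integral_cong) (simp add: indicator_def)
    also have "\<dots> = (\<integral>\<^sup>+x. ennreal (w x) * (ennreal (x ^ n) * indicator {S y1<..S b} x) \<partial>lborel)"
      by (rule transfer) simp
    also have "\<dots> \<le> (\<integral>\<^sup>+x. ennreal (x ^ n * w x * indicator {S y1..S b} x) \<partial>lborel)"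
    proof (rule nn_integral_mono)
      fix x
      show "ennreal (w x) * (ennreal (x ^ n) * indicator {S y1<..S b} x)
          \<le> ennreal (x ^ n * w x * indicator {S y1..S b} x)"
        using w_nonneg[of x] x0_S y1 S_ge[of y1]
        by (cases "x \<in> {S y1<..S b}") (simp_all add: ennreal_mult'[symmetric] mult.commute)
    qed
    also have "\<dots> = (\<integral>\<^sup>+y. ennreal (S y ^ n * w (S y) * S' y * indicator {y1..b} y) \<partial>lborel)"
      using b by (intro nn_integral_substitution S_deriv S'_nonneg continuous_on_subset[OF S'_cont])
        (auto simp: set_borel_measurable_def)
    also have "\<dots> \<le> (\<integral>\<^sup>+y. (ennreal q * ennreal (y ^ n) + ennreal K) * ennreal (w y) \<partial>lborel)"
    proof (rule nn_integral_mono)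
      fix y
      show "ennreal (S y ^ n * w (S y) * S' y * indicator {y1..b} y)
          \<le> (ennreal q * ennreal (y ^ n) + ennreal K) * ennreal (w y)"
      proof (cases "y \<in> {y1..b}")
        case True
        then have "S y ^ n * w (S y) * S' y \<le> (q * y ^ n + K) * w y"
          using contraction[of y] S_ge[of y] y1 by (simp add: w_def)
        then have "ennreal (S y ^ n * w (S y) * S' y) \<le> ennreal ((q * y ^ n + K) * w y)"
          by (rule ennreal_leI)
        also have "\<dots> = (ennreal q * ennreal (y ^ n) + ennreal K) * ennreal (w y)"
          using True y1 q \<open>0 \<le> K\<close> w_nonneg[of y]
          by (simp add: ennreal_mult ennreal_plus)
        finally show ?thesis using True by simp
      qed simp
    qed
    also have "\<dots> = (\<integral>\<^sup>+y. ennreal (w y) * (ennreal q * ennreal (y ^ n) + ennreal K) \<partial>lborel)"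
      by (simp add: mult.commute)
    also have "\<dots> = (\<integral>\<^sup>+x. (ennreal q * ennreal (x ^ n) + ennreal K) * indicator {x0<..} x \<partial>D)"
      by (rule transfer[symmetric]) simp
    also have "\<dots> \<le> (\<integral>\<^sup>+x. ennreal q * ennreal (x ^ n) + ennreal K \<partial>D)"
      by (intro nn_integral_mono) (simp add: indicator_def)
    also have "\<dots> = ennreal q * ennreal m + ennreal K"
      by (subst nn_integral_add) (simp_all add: nn_integral_cmult m emeasure_space_1[unfolded space_eq_univ])
    also have "\<dots> = ennreal (q * m + K)"
      using q \<open>0 \<le> K\<close> m_nonneg by (simp add: ennreal_mult ennreal_plus)
    finally show ?thesis .
  qed
  have "(\<integral>\<^sup>+x. ennreal (x ^ n) * indicator {S y1<..} x \<partial>D) \<le> ennreal (q * m + K)"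
  proof -
    define h where "h k x = ennreal (x ^ n) * indicator {S y1<..S (y1 + real k)} x" for k :: nat and x :: real
    have lim: "(\<lambda>k. h k x) \<longlonglongrightarrow> ennreal (x ^ n) * indicator {S y1<..} x" for x
    proof (rule tendsto_eventually)
      obtain N where N: "x - y1 \<le> real N" using real_arch_simple by blast
      have "x \<le> S (y1 + real k)" if "k \<ge> N" for k
        using S_ge[of "y1 + real k"] N that by simp
      then have "h k x = ennreal (x ^ n) * indicator {S y1<..} x" if "k \<ge> N" for k
        using that by (simp add: h_def indicator_def)
      then show "eventually (\<lambda>k. h k x = ennreal (x ^ n) * indicator {S y1<..} x) sequentially"
        unfolding eventually_sequentially by blast
    qed
    have "(\<integral>\<^sup>+x. ennreal (x ^ n) * indicator {S y1<..} x \<partial>D) = (\<integral>\<^sup>+x. liminf (\<lambda>k. h k x) \<partial>D)"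
      by (intro nn_integral_cong lim_imp_Liminf[symmetric] sequentially_bot lim)
    also have "\<dots> \<le> liminf (\<lambda>k. \<integral>\<^sup>+x. h k x \<partial>D)"
      by (rule nn_integral_liminf) (simp add: h_def)
    also have "\<dots> \<le> liminf (\<lambda>k. ennreal (q * m + K))"
      by (intro Liminf_mono always_eventually allI) (simp add: h_def piece)
    finally show ?thesis by (simp add: Liminf_const)
  qed
  moreover have "(\<integral>\<^sup>+x. ennreal (x ^ n) * indicator {..S y1} x \<partial>D) \<le> ennreal (S y1 ^ n)"
  proof -
    have "(\<integral>\<^sup>+x. ennreal (x ^ n) * indicator {..S y1} x \<partial>D) \<le> (\<integral>\<^sup>+x. ennreal (S y1 ^ n) \<partial>D)"
    proof (rule nn_integral_mono_AE)
      show "AE x in D. ennreal (x ^ n) * indicator {..S y1} x \<le> ennreal (S y1 ^ n)"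
        using D(2) by eventually_elim (auto simp: indicator_def intro!: ennreal_leI power_mono)
    qed
    then show ?thesis by (simp add: emeasure_space_1[unfolded space_eq_univ])
  qed
  moreover have "(\<integral>\<^sup>+x. ennreal (x ^ n) \<partial>D) = (\<integral>\<^sup>+x. ennreal (x ^ n) * indicator {..S y1} x \<partial>D)
      + (\<integral>\<^sup>+x. ennreal (x ^ n) * indicator {S y1<..} x \<partial>D)"
    by (subst nn_integral_add[symmetric]) (auto intro!: nn_integral_cong simp: indicator_def)
  ultimately have "ennreal m \<le> ennreal (S y1 ^ n) + ennreal (q * m + K)"
    unfolding m by (simp add: add_mono)
  also have "\<dots> = ennreal (S y1 ^ n + (q * m + K))"
    using S_ge[of y1] y1 q \<open>0 \<le> K\<close> m_nonneg by (simp add: ennreal_plus)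
  finally have "m \<le> S y1 ^ n + (q * m + K)"
    using S_ge[of y1] y1 q \<open>0 \<le> K\<close> m_nonneg by (subst (asm) ennreal_le_iff) auto
  then have "m * (1 - q) \<le> S y1 ^ n + K" by (simp add: algebra_simps)
  then show ?thesis using q unfolding m_def[symmetric] by (simp add: pos_le_divide_eq)
qed

text \<open>
The only properties of \<open>\<phi>\<close> that matter: it is eventually nonnegative and \<open>C\<^sup>1\<close>, at most a multiple of the
logarithm, with derivative of order \<open>1 / x\<close>.
\<close>

lemma phi_growth:
  fixes \<phi> :: "real \<Rightarrow> real"
  assumes "a > 0" and \<alpha>: "\<alpha> \<in> {0..1}" and \<phi>: "\<phi> \<in> {phi1 a \<alpha>, phi2 a \<alpha>, phi3 a \<alpha>}"
  obtains \<phi>' C X where "C > 0"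
    "\<And>x. x \<ge> X \<Longrightarrow> (\<phi> has_real_derivative \<phi>' x) (at x)"
    "\<And>x. x \<ge> X \<Longrightarrow> isCont \<phi>' x"
    "\<And>x. x \<ge> X \<Longrightarrow> \<bar>\<phi>' x\<bar> \<le> C / x"
    "\<And>x. x \<ge> X \<Longrightarrow> 0 \<le> \<phi> x"
    "\<And>x. x \<ge> X \<Longrightarrow> \<phi> x \<le> C * ln x"
proof -
  \<comment> \<open>Beyond this point both \<open>ln x\<close> and \<open>ln (ln x)\<close> are at least 1, which controls every denominator.\<close>
  define X :: real where "X = exp (exp 1)"
  define C where "C = 2 * a + 1"
  define d1 where "d1 x = a * (\<alpha> * ln x powr (\<alpha> - 1)) / x" for x
  define d2 where "d2 x = d1 x + 1 / (x * ln x)" for x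
  define d3 where "d3 x = (d1 x * ln (ln x) - a * ln x powr \<alpha> / (x * ln x)) / (ln (ln x))\<^sup>2" for x
  have X: "x > 0" "x > 1" "ln x \<ge> exp 1" "ln x \<ge> 1" "ln x > 0" "ln (ln x) \<ge> 1" "ln x > 1" if "x \<ge> X" for x
  proof -
    show "x > 0" using less_le_trans[OF exp_gt_zero that[unfolded X_def]] .
    then show e: "ln x \<ge> exp 1" using that by (simp add: X_def ln_ge_iff)
    show one: "ln x \<ge> 1" using e one_le_exp_iff[of 1] by linarith
    then show pos: "ln x > 0" by simp
    then show "x > 1" using \<open>x > 0\<close> by simp
    show "ln (ln x) \<ge> 1" using e pos by (simp add: ln_ge_iff)
    show "ln x > 1" using e exp_gt_one[of "1::real"] by linarith
  qed
  have powr_le: "ln x powr \<alpha> \<le> ln x" "\<alpha> * ln x powr (\<alpha> - 1) \<le> 1" "0 \<le> \<alpha> * ln x powr (\<alpha> - 1)" if "x \<ge> X" for x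
  proof -
    show "ln x powr \<alpha> \<le> ln x" using powr_mono[of \<alpha> 1 "ln x"] \<alpha> X[OF that] by simp
    have "ln x powr (\<alpha> - 1) \<le> 1" using powr_mono[of "\<alpha> - 1" 0 "ln x"] \<alpha> X[OF that] by simp
    then show "\<alpha> * ln x powr (\<alpha> - 1) \<le> 1" using \<alpha> by (intro mult_le_one) auto
    show "0 \<le> \<alpha> * ln x powr (\<alpha> - 1)" using \<alpha> by simp
  qed
  have d1: "0 \<le> d1 x" "d1 x \<le> a / x" if "x \<ge> X" for x
    using powr_le[OF that] X[OF that] \<open>a > 0\<close> mult_left_mono[OF powr_le(2)[OF that], of a]
    by (simp_all add: d1_def divide_right_mono)
  have ln_le: "ln (ln x) \<le> ln x" if "x \<ge> X" for x
    using ln_bound[of "ln x"] X[OF that] by simp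
  have isCont: "isCont d1 x" "isCont d2 x" "isCont d3 x" if "x \<ge> X" for x
    unfolding d1_def d2_def d3_def using X[OF that]
    by (auto intro!: continuous_intros)
  have D1: "(phi1 a \<alpha> has_real_derivative d1 x) (at x)" if "x \<ge> X" for x
    unfolding phi1_def[abs_def] d1_def using X[OF that]
    by (auto intro!: derivative_eq_intros simp: field_simps powr_diff)
  have D2: "(phi2 a \<alpha> has_real_derivative d2 x) (at x)" if "x \<ge> X" for x
    unfolding phi2_def[abs_def] d2_def 
    by (rule DERIV_add[OF D1[OF that, unfolded phi1_def[abs_def]]])
       (use X[OF that] in \<open>auto intro!: derivative_eq_intros simp: field_simps\<close>)
  have lnln: "((\<lambda>x. ln (ln x)) has_real_derivative 1 / (x * ln x)) (at x)" if "x \<ge> X" for x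
    using X[OF that] by (auto intro!: derivative_eq_intros simp: field_simps)
  have D3: "(phi3 a \<alpha> has_real_derivative d3 x) (at x)" if "x \<ge> X" for x
  proof -
    have "ln (ln x) \<noteq> 0" using X(6)[OF that] by linarith
    from DERIV_divide[OF D1[OF that, unfolded phi1_def[abs_def]] lnln[OF that] this] show ?thesis
      by (simp add: phi3_def[abs_def] d3_def power2_eq_square)
  qed
  have bound1: "\<bar>d1 x\<bar> \<le> C / x" "0 \<le> phi1 a \<alpha> x" "phi1 a \<alpha> x \<le> C * ln x" if "x \<ge> X" for x
  proof -
    have "a / x \<le> C / x" using X[OF that] \<open>a > 0\<close> by (intro divide_right_mono) (auto simp: C_def)
    then show "\<bar>d1 x\<bar> \<le> C / x" using d1[OF that] by simp
    show "0 \<le> phi1 a \<alpha> x" using \<open>a > 0\<close> by (simp add: phi1_def)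
    show "phi1 a \<alpha> x \<le> C * ln x" unfolding phi1_def using \<open>a > 0\<close> powr_le[OF that] X[OF that]
      by (intro mult_mono) (auto simp: C_def)
  qed
  have bound2: "\<bar>d2 x\<bar> \<le> C / x" "0 \<le> phi2 a \<alpha> x" "phi2 a \<alpha> x \<le> C * ln x" if "x \<ge> X" for x
  proof -
    have "1 / (x * ln x) \<le> 1 / x" using X[OF that] by (simp add: field_simps)
    moreover have "a / x + 1 / x \<le> C / x"
      using X[OF that] \<open>a > 0\<close> by (simp add: C_def field_simps)
    moreover have "0 \<le> 1 / (x * ln x)" using X[OF that] by simp
    ultimately show "\<bar>d2 x\<bar> \<le> C / x" using d1[OF that] unfolding d2_def by linarith
    show "0 \<le> phi2 a \<alpha> x" using \<open>a > 0\<close> X[OF that] by (simp add: phi2_def)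
    have "phi2 a \<alpha> x \<le> a * ln x + ln x" unfolding phi2_def
      using \<open>a > 0\<close> powr_le[OF that] ln_le[OF that] by (intro add_mono mult_left_mono) auto
    also have "\<dots> \<le> C * ln x" using \<open>a > 0\<close> X[OF that] by (simp add: C_def algebra_simps)
    finally show "phi2 a \<alpha> x \<le> C * ln x" .
  qed
  have bound3: "\<bar>d3 x\<bar> \<le> C / x" "0 \<le> phi3 a \<alpha> x" "phi3 a \<alpha> x \<le> C * ln x" if "x \<ge> X" for x
  proof -
    define u v where "u = d1 x / ln (ln x)" and "v = a * ln x powr \<alpha> / (x * ln x) / (ln (ln x))\<^sup>2"
    have "d3 x = u - v"
      using X[OF that] by (simp add: d3_def u_def v_def power2_eq_square diff_divide_distrib)
    moreover have "0 \<le> u" "0 \<le> v" 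
      using X[OF that] d1[OF that] \<open>a > 0\<close> by (simp_all add: u_def v_def)
    moreover have "u \<le> d1 x / 1" unfolding u_def using X[OF that] d1[OF that] by (intro divide_left_mono) auto
    moreover have "v \<le> a * ln x powr \<alpha> / (x * ln x) / 1" 
      unfolding v_def using X[OF that] \<open>a > 0\<close> by (intro divide_left_mono) (auto simp: one_le_power)
    moreover have "a * ln x powr \<alpha> / (x * ln x) \<le> a * ln x / (x * ln x)"
      using X[OF that] powr_le[OF that] \<open>a > 0\<close> by (intro divide_right_mono mult_left_mono) auto
    moreover have "a * ln x / (x * ln x) = a / x" using X[OF that] by simp
    moreover have "a / x + a / x \<le> C / x"
      using X[OF that] \<open>a > 0\<close> by (simp add: C_def field_simps)
    ultimately show "\<bar>d3 x\<bar> \<le> C / x" using d1[OF that] by linarith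
    show "0 \<le> phi3 a \<alpha> x" using \<open>a > 0\<close> X[OF that] by (simp add: phi3_def)
    have "phi3 a \<alpha> x \<le> a * ln x powr \<alpha> / 1" unfolding phi3_def
      using \<open>a > 0\<close> X[OF that] by (intro divide_left_mono) auto
    also have "\<dots> \<le> C * ln x" using bound1(3)[OF that] by (simp add: phi1_def)
    finally show "phi3 a \<alpha> x \<le> C * ln x" .
  qed
  have C: "C > 0" using \<open>a > 0\<close> by (simp add: C_def)
  consider "\<phi> = phi1 a \<alpha>" | "\<phi> = phi2 a \<alpha>" | "\<phi> = phi3 a \<alpha>" using \<phi> by blast
  then show ?thesis
  proof cases
    case 1
    then show ?thesis using D1 isCont(1) bound1 by (intro that[of C X d1] C) simp_all
  next
    case 2
    then show ?thesis using D2 isCont(2) bound2 by (intro that[of C X d2] C) simp_all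
  next
    case 3
    then show ?thesis using D3 isCont(3) bound3 by (intro that[of C X d3] C) simp_all
  qed
qed

text \<open>
Put \<open>S y = (sqrt y + \<phi> (sqrt y))\<^sup>2\<close>. The limsup hypothesis says \<open>g (S y) \<le> \<rho> * g y\<close> for large \<open>y\<close> with some
\<open>\<rho> < 1\<close>, and \<open>S' y\<close> tends to 1. For the \<open>n\<close>-th moment one also needs \<open>S y ^ n\<close> to exceed \<open>y ^ n\<close> by a
factor close to 1 only. Since the ratio of the two is at most \<open>exp (2 * n * C * ln (sqrt y) / sqrt y)\<close>,
this holds as soon as \<open>sqrt y\<close> is beyond a multiple of \<open>n * ln (n + 2)\<close>. Below that threshold \<open>S y ^ n\<close> is
bounded by \<open>R\<close>, the \<open>2 * n\<close>-th power of such a multiple, and this is the size of the moment.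
\<close>

lemma moment_growth:
  fixes \<phi> \<phi>' :: "real \<Rightarrow> real"
  assumes D: "real_distribution D" "AE x in D. 0 \<le> x" "\<And>n::nat. n \<ge> 1 \<Longrightarrow> integrable D (\<lambda>x. x ^ n)"
    and abs_cont: "abs_cont_from_with_density (cdf D) x0 g"
    and g_pos: "\<And>x. x \<ge> x0 \<Longrightarrow> 0 < g x"
    and "C > 0"
    and deriv: "\<And>x. x \<ge> X \<Longrightarrow> (\<phi> has_real_derivative \<phi>' x) (at x)"
    and cont: "\<And>x. x \<ge> X \<Longrightarrow> isCont \<phi>' x"
    and deriv_bound: "\<And>x. x \<ge> X \<Longrightarrow> \<bar>\<phi>' x\<bar> \<le> C / x"
    and nonneg: "\<And>x. x \<ge> X \<Longrightarrow> 0 \<le> \<phi> x"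
    and log_bound: "\<And>x. x \<ge> X \<Longrightarrow> \<phi> x \<le> C * ln x"
    and limsup: "Limsup at_top (\<lambda>x. ereal (g ((x + \<phi> x)\<^sup>2) / g (x\<^sup>2))) < 1"
  obtains A where "A > 0"
    "\<And>n::nat. n \<ge> 1 \<Longrightarrow> (\<integral>x. x ^ n \<partial>D) \<le> (A * (real n * ln (real n + 2))) ^ (2 * n)"
proof -
  obtain r where r: "Limsup at_top (\<lambda>x. ereal (g ((x + \<phi> x)\<^sup>2) / g (x\<^sup>2))) < ereal r" "ereal r < 1"
    using ereal_dense2[OF limsup] by blast
  define \<rho> where "\<rho> = max r (1 / 2)"
  have \<rho>: "0 < \<rho>" "\<rho> < 1" using r(2) by (auto simp: \<rho>_def one_ereal_def)
  \<comment> \<open>Small enough that \<open>\<rho> * (1 + \<eta>) ^ 3 < 1\<close>: two factors pay for \<open>S'\<close>, one for \<open>S y ^ n / y ^ n\<close>. Here \<open>(1 + \<eta>) ^ 3 \<le> 1 + 7 * \<eta>\<close>.\<close>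
  define \<eta> where "\<eta> = (1 - \<rho>) / 14"
  have \<eta>: "0 < \<eta>" "\<eta> \<le> 1" using \<rho> by (auto simp: \<eta>_def)
  define q where "q = \<rho> * (1 + \<eta>) ^ 3"
  have q: "0 \<le> q" "q < 1"
  proof -
    have "\<eta> ^ 2 \<le> \<eta>" "\<eta> ^ 3 \<le> \<eta>"
      using power_decreasing[of 1 2 \<eta>] power_decreasing[of 1 3 \<eta>] \<eta> by simp_all
    then have "(1 + \<eta>) ^ 3 \<le> 1 + 7 * \<eta>"
      by (simp add: power3_eq_cube power2_eq_square algebra_simps)
    then have "q \<le> \<rho> * (1 + 7 * \<eta>)" unfolding q_def using \<rho> by (intro mult_left_mono) auto
    also have "\<dots> = \<rho> + \<rho> * ((1 - \<rho>) / 2)" by (simp add: \<eta>_def field_simps)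
    also have "\<rho> * ((1 - \<rho>) / 2) \<le> 1 * ((1 - \<rho>) / 2)" using \<rho> by (intro mult_right_mono) auto
    finally have "q \<le> \<rho> + 1 * ((1 - \<rho>) / 2)" by simp
    then have "q \<le> (1 + \<rho>) / 2" by (simp add: field_simps)
    then show "q < 1" using \<rho> by simp
    show "0 \<le> q" using \<rho> \<eta> by (simp add: q_def)
  qed
  have "eventually (\<lambda>x. g ((x + \<phi> x)\<^sup>2) / g (x\<^sup>2) < \<rho>) at_top"
    using Limsup_lessD[OF r(1)] by eventually_elim (simp add: \<rho>_def)
  moreover have "eventually (\<lambda>x. C * ln x \<le> \<eta> * x) at_top"
    using \<eta> \<open>C > 0\<close> by real_asymp
  moreover have "eventually (\<lambda>x. C / x \<le> \<eta>) at_top"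
    using \<eta> \<open>C > 0\<close> by real_asymp
  ultimately have "eventually (\<lambda>x. g ((x + \<phi> x)\<^sup>2) / g (x\<^sup>2) < \<rho> \<and> C * ln x \<le> \<eta> * x \<and> C / x \<le> \<eta>) at_top"
    by eventually_elim simp
  then obtain X1 where X1: "\<And>x. x \<ge> X1 \<Longrightarrow> g ((x + \<phi> x)\<^sup>2) / g (x\<^sup>2) < \<rho>"
    "\<And>x. x \<ge> X1 \<Longrightarrow> C * ln x \<le> \<eta> * x" "\<And>x. x \<ge> X1 \<Longrightarrow> C / x \<le> \<eta>"
    unfolding eventually_at_top_linorder by blast
  define z where "z = Max {X, X1, 1, \<bar>x0\<bar> + 1}"
  have z: "X \<le> z" "X1 \<le> z" "1 \<le> z" "\<bar>x0\<bar> + 1 \<le> z" by (simp_all add: z_def)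
  define y1 where "y1 = z\<^sup>2"
  have "z \<le> y1" using z mult_left_mono[of 1 z z] by (simp add: y1_def power2_eq_square)
  then have y1: "x0 < y1" "0 < y1" using z by auto
  have root: "sqrt y \<ge> z" "sqrt y > 0" "(sqrt y)\<^sup>2 = y" "y > 0" if "y \<ge> y1" for y
  proof -
    show "sqrt y \<ge> z" using that z by (simp add: y1_def real_le_rsqrt)
    then show "sqrt y > 0" using z by linarith
    then show "y > 0" by simp
    then show "(sqrt y)\<^sup>2 = y" by simp
  qed
  define S where "S y = (sqrt y + \<phi> (sqrt y))\<^sup>2" for y
  define S' where "S' y = (1 + \<phi>' (sqrt y)) * (sqrt y + \<phi> (sqrt y)) / sqrt y" for y
  have phi_small: "0 \<le> \<phi> (sqrt y)" "\<phi> (sqrt y) \<le> \<eta> * sqrt y" "\<bar>\<phi>' (sqrt y)\<bar> \<le> \<eta>" if "y \<ge> y1" for y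
    using nonneg[of "sqrt y"] log_bound[of "sqrt y"] deriv_bound[of "sqrt y"] X1(2,3)[of "sqrt y"] root(1)[OF that] z
    by auto
  have S_deriv: "(S has_real_derivative S' y) (at y)" if "y \<ge> y1" for y
  proof -
    have "sqrt y \<ge> X" using root(1)[OF that] z by linarith
    then have "((\<lambda>y. \<phi> (sqrt y)) has_real_derivative \<phi>' (sqrt y) * (inverse (sqrt y) / 2)) (at y)"
      using root(4)[OF that] by (intro DERIV_chain2[OF deriv] DERIV_real_sqrt)
    then have "((\<lambda>y. (sqrt y + \<phi> (sqrt y))\<^sup>2) has_real_derivative
        2 * (sqrt y + \<phi> (sqrt y)) * (inverse (sqrt y) / 2 + \<phi>' (sqrt y) * (inverse (sqrt y) / 2))) (at y)"
      using root(4)[OF that] by (auto intro!: derivative_eq_intros DERIV_real_sqrt)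
    moreover have "2 * (sqrt y + \<phi> (sqrt y)) * (inverse (sqrt y) / 2 + \<phi>' (sqrt y) * (inverse (sqrt y) / 2)) = S' y"
      using root(2)[OF that] by (simp add: S'_def field_simps)
    ultimately show ?thesis by (simp add: S_def[abs_def])
  qed
  have S'_cont: "continuous_on {y1..} S'"
  proof (rule continuous_at_imp_continuous_on, rule ballI)
    fix y assume "y \<in> {y1..}"
    then have y: "y \<ge> y1" by simp
    then have ge: "sqrt y \<ge> X" "sqrt y \<noteq> 0" using root[OF y] z by linarith+
    have "isCont (\<lambda>y. \<phi>' (sqrt y)) y" "isCont (\<lambda>y. \<phi> (sqrt y)) y"
      using cont[OF ge(1)] DERIV_isCont[OF deriv[OF ge(1)]]
      by (auto intro!: isCont_o2[of y sqrt] isCont_real_sqrt)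
    then show "isCont S' y" unfolding S'_def using ge(2) by (intro continuous_intros) auto
  qed
  have S'_bounds: "0 \<le> S' y" "S' y \<le> (1 + \<eta>)\<^sup>2" if "y \<ge> y1" for y
  proof -
    have ratio: "0 \<le> (sqrt y + \<phi> (sqrt y)) / sqrt y" "(sqrt y + \<phi> (sqrt y)) / sqrt y \<le> 1 + \<eta>"
      using phi_small[OF that] root(2)[OF that] by (simp_all add: field_simps)
    have der: "0 \<le> 1 + \<phi>' (sqrt y)" "1 + \<phi>' (sqrt y) \<le> 1 + \<eta>" using phi_small(3)[OF that] \<eta> by auto
    show "0 \<le> S' y" using mult_nonneg_nonneg[OF der(1) ratio(1)] by (simp add: S'_def)
    show "S' y \<le> (1 + \<eta>)\<^sup>2" using mult_mono[OF der(2) ratio(2) _ ratio(1)] \<eta>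
      by (simp add: S'_def power2_eq_square)
  qed
  have S_ge: "y \<le> S y" if "y \<ge> y1" for y
    using power_mono[of "sqrt y" "sqrt y + \<phi> (sqrt y)" 2] phi_small(1)[OF that] root[OF that]
    by (simp add: S_def)
  have S_le: "S y \<le> 4 * y" if "y \<ge> y1" for y
  proof -
    have "\<eta> * sqrt y \<le> 1 * sqrt y" using root(2)[OF that] \<eta> by (intro mult_right_mono) auto
    with phi_small(2)[OF that] have "\<phi> (sqrt y) \<le> sqrt y" by (metis mult_1 order_trans)
    then have "S y \<le> (2 * sqrt y)\<^sup>2"
      unfolding S_def using phi_small(1)[OF that] root(2)[OF that] by (intro power_mono) auto
    then show ?thesis using root(3)[OF that] by (simp add: power_mult_distrib)
  qed
  have g_S: "g (S y) \<le> \<rho> * g y" if "y \<ge> y1" for y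
    using X1(1)[of "sqrt y"] root[OF that] z g_pos[of y] y1 that
    by (simp add: S_def pos_divide_less_eq)
  have "ln (1 + \<eta>) / (2 * C) > 0" using \<eta> \<open>C > 0\<close> by (simp add: ln_gt_zero)
  then obtain K where K: "K \<ge> 1" "\<And>n x. n \<ge> (1::nat) \<Longrightarrow> x \<ge> K * real n * ln (real n + 2)
      \<Longrightarrow> real n * ln x \<le> ln (1 + \<eta>) / (2 * C) * x"
    by (rule ln_le_linear_beyond_n_ln) blast
  define L where "L n = real n * ln (real n + 2)" for n :: nat
  have L: "L n \<ge> 1" if "n \<ge> 1" for n
  proof -
    have "exp 1 \<le> real n + 2" using exp_le that by linarith
    then have "1 * 1 \<le> real n * ln (real n + 2)"
      using that by (intro mult_mono) (auto simp: ln_ge_iff)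
    then show ?thesis by (simp add: L_def)
  qed
  define A0 where "A0 = max (sqrt (S y1)) (2 * K)"
  have A0: "A0 \<ge> 2" "sqrt (S y1) \<le> A0" "2 * K \<le> A0" using K(1) by (auto simp: A0_def)
  \<comment> \<open>The factor \<open>2 / (1 - q)\<close> is at least 1, so it can be moved inside the \<open>2 * n\<close>-th power.\<close>
  define A where "A = 2 / (1 - q) * A0"
  have bound: "(\<integral>x. x ^ n \<partial>D) \<le> (A * L n) ^ (2 * n)" if n: "n \<ge> 1" for n
  proof -
    have far: "S y ^ n \<le> (1 + \<eta>) * y ^ n" if y: "y \<ge> y1" "sqrt y \<ge> K * L n" for y
    proof -
      have "\<phi> (sqrt y) / sqrt y \<le> C * ln (sqrt y) / sqrt y"
        using log_bound[of "sqrt y"] root[OF y(1)] z by (intro divide_right_mono) auto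
      then have "1 + \<phi> (sqrt y) / sqrt y \<le> 1 + C * ln (sqrt y) / sqrt y" by simp
      also have "\<dots> \<le> exp (C * ln (sqrt y) / sqrt y)" by (rule exp_ge_add_one_self)
      finally have "(1 + \<phi> (sqrt y) / sqrt y) ^ (2 * n) \<le> exp (C * ln (sqrt y) / sqrt y) ^ (2 * n)"
        using phi_small(1)[OF y(1)] root(2)[OF y(1)] by (intro power_mono) auto
      also have "\<dots> = exp (2 * C * (real n * ln (sqrt y)) / sqrt y)"
        by (simp add: exp_of_nat_mult[symmetric] mult_ac)
      also have "\<dots> \<le> exp (ln (1 + \<eta>))"
      proof -
        have "real n * ln (sqrt y) \<le> ln (1 + \<eta>) / (2 * C) * sqrt y"
          using y(2) by (intro K(2) n) (simp add: L_def mult.assoc)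
        then have "2 * C * (real n * ln (sqrt y)) \<le> 2 * C * (ln (1 + \<eta>) / (2 * C) * sqrt y)"
          using \<open>C > 0\<close> by (intro mult_left_mono) auto
        also have "\<dots> = ln (1 + \<eta>) * sqrt y" using \<open>C > 0\<close> by simp
        finally show ?thesis using root(2)[OF y(1)] by (simp add: pos_divide_le_eq)
      qed
      also have "\<dots> = 1 + \<eta>" using \<eta> by simp
      finally have factor: "(1 + \<phi> (sqrt y) / sqrt y) ^ (2 * n) \<le> 1 + \<eta>" .
      have "sqrt y + \<phi> (sqrt y) = sqrt y * (1 + \<phi> (sqrt y) / sqrt y)"
        using root(2)[OF y(1)] by (simp add: field_simps)
      then have "S y ^ n = (sqrt y * (1 + \<phi> (sqrt y) / sqrt y)) ^ (2 * n)"
        by (simp only: S_def power_mult)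
      also have "\<dots> = y ^ n * (1 + \<phi> (sqrt y) / sqrt y) ^ (2 * n)"
        using root(3)[OF y(1)] by (simp only: power_mult_distrib power_mult[of "sqrt y"])
      also have "\<dots> \<le> y ^ n * (1 + \<eta>)"
        using factor root(4)[OF y(1)] by (intro mult_left_mono) auto
      finally show ?thesis by (simp add: mult.commute)
    qed
    define R where "R = (A0 * L n) ^ (2 * n)"
    have R_nonneg: "R \<ge> 0" using A0 L[OF n] by (simp add: R_def)
    have near: "S y ^ n \<le> R" if y: "y \<ge> y1" "sqrt y \<le> K * L n" for y
    proof -
      have "y \<le> (K * L n)\<^sup>2"
        using power_mono[OF y(2), of 2] root[OF y(1)] by simp
      then have "S y \<le> (2 * K * L n)\<^sup>2" using S_le[OF y(1)] by (simp add: power_mult_distrib)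
      also have "\<dots> \<le> (A0 * L n)\<^sup>2"
        using A0 K(1) L[OF n] by (intro power_mono mult_right_mono) auto
      finally have "S y ^ n \<le> ((A0 * L n)\<^sup>2) ^ n"
        using S_ge[OF y(1)] root(4)[OF y(1)] by (intro power_mono) auto
      then show ?thesis by (simp only: R_def power_mult)
    qed
    have start: "S y1 ^ n \<le> R"
    proof -
      have S1: "S y1 \<ge> 0" using S_ge[of y1] y1 by simp
      have "sqrt (S y1) * 1 \<le> A0 * L n"
        using A0 L[OF n] S1 by (intro mult_mono) auto
      then have "(sqrt (S y1)) ^ (2 * n) \<le> R" unfolding R_def using S1 by (intro power_mono) auto
      then show ?thesis using S1 by (simp add: power_mult)
    qed
    have contraction: "S y ^ n * g (S y) * S' y \<le> (q * y ^ n + R) * g y" if y: "y \<ge> y1" for y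
    proof -
      have g: "g y > 0" "g (S y) > 0" using g_pos[of y] g_pos[of "S y"] S_ge[OF y] y y1 by auto
      have Sn: "0 \<le> S y ^ n" using S_ge[OF y] root(4)[OF y] by simp
      have "g (S y) * S' y \<le> \<rho> * g y * (1 + \<eta>)\<^sup>2"
        using g_S[OF y] S'_bounds[OF y] g \<rho> by (intro mult_mono) auto
      from mult_left_mono[OF this Sn] have le: "S y ^ n * g (S y) * S' y \<le> S y ^ n * (\<rho> * (1 + \<eta>)\<^sup>2) * g y"
        by (simp add: mult_ac)
      have "S y ^ n * (\<rho> * (1 + \<eta>)\<^sup>2) \<le> q * y ^ n + R"
      proof (cases "sqrt y \<ge> K * L n")
        case True
        have "S y ^ n * (\<rho> * (1 + \<eta>)\<^sup>2) \<le> (1 + \<eta>) * y ^ n * (\<rho> * (1 + \<eta>)\<^sup>2)"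
          using far[OF y True] \<rho> by (intro mult_right_mono) auto
        also have "\<dots> = q * y ^ n" by (simp add: q_def power3_eq_cube power2_eq_square)
        finally show ?thesis using R_nonneg by simp
      next
        case False
        have "\<rho> * (1 + \<eta>)\<^sup>2 \<le> \<rho> * (1 + \<eta>) ^ 3"
          using \<rho> \<eta> by (intro mult_left_mono power_increasing) auto
        then have "\<rho> * (1 + \<eta>)\<^sup>2 \<le> 1" using q by (simp add: q_def)
        then have "S y ^ n * (\<rho> * (1 + \<eta>)\<^sup>2) \<le> S y ^ n * 1" using Sn by (intro mult_left_mono)
        also have "\<dots> \<le> R" using near[OF y] False by simp
        finally show ?thesis using q root(4)[OF y] by (simp add: add_increasing)
      qed
      then show ?thesis using le mult_right_mono[of _ _ "g y"] g by (meson less_imp_le order_trans)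
    qed
    have "(\<integral>x. x ^ n \<partial>D) \<le> (S y1 ^ n + R) / (1 - q)"
      by (rule moment_bound_by_substitution[OF D(1,2) D(3)[OF n] abs_cont g_pos y1 S_deriv S'_cont
            S'_bounds(1) S_ge contraction q R_nonneg])
    also have "\<dots> \<le> 2 / (1 - q) * R" using start q by (simp add: divide_right_mono)
    also have "\<dots> \<le> (2 / (1 - q)) ^ (2 * n) * R"
    proof -
      have "1 \<le> 2 / (1 - q)" using q by simp
      then show ?thesis using R_nonneg n power_increasing[of 1 "2 * n" "2 / (1 - q)"]
        by (intro mult_right_mono) auto
    qed
    also have "\<dots> = (A * L n) ^ (2 * n)" by (simp only: A_def R_def power_mult_distrib mult.assoc)
    finally show ?thesis .
  qed
  have "A > 0" using A0 q by (simp add: A_def)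
  then show ?thesis using bound unfolding L_def by (rule that)
qed

text \<open>
In the Carleman condition a moment equal to 0 would count as a zero summand; positivity of the density
on a set of positive length excludes this.
\<close>

lemma moment_pos_if_density_pos:
  assumes D: "real_distribution D" "AE x in D. 0 \<le> x" "integrable D (\<lambda>x. x ^ n)"
    and abs_cont: "abs_cont_from_with_density (cdf D) x0 g"
    and g_pos: "\<And>x. x \<ge> x0 \<Longrightarrow> 0 < g x" and "0 \<le> x0"
  shows "0 < (\<integral>x. x ^ n \<partial>D)"
proof (rule ccontr)
  interpret real_distribution D by fact
  assume "\<not> ?thesis"
  moreover have "0 \<le> (\<integral>x. x ^ n \<partial>D)" using D(2) by (intro integral_nonneg_AE) auto
  ultimately have "(\<integral>x. x ^ n \<partial>D) = 0" by simp
  then have "AE x in D. x ^ n = 0"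
    using D(2,3) by (subst integral_nonneg_eq_0_iff_AE[symmetric]) auto
  then have "AE x in D. x \<notin> {x0<..}"
  proof eventually_elim
    case (elim x)
    then show ?case using \<open>0 \<le> x0\<close> by simp
  qed
  then have "{x0<..} \<in> null_sets D"
    by (subst AE_iff_null_sets) auto
  then have "emeasure D {x0<..} = 0" by (simp add: null_sets_def)
  then have "emeasure (density D (indicator {x0<..})) UNIV = 0"
    by (subst emeasure_restricted) simp_all
  note density = density_from_abs_cont_cdf[OF D(1) abs_cont less_imp_le[OF g_pos]]
  have [measurable]: "(\<lambda>x. indicator {x0<..} x * g x) \<in> borel_measurable borel"
    by (rule density(1)) auto
  have "density D (indicator {x0<..}) = density lborel (\<lambda>x. ennreal (indicator {x0<..} x * g x))"
    by (rule density(2)) auto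
  then have "(\<integral>\<^sup>+x. ennreal (indicator {x0<..} x * g x) \<partial>lborel) = 0"
    using \<open>emeasure (density D (indicator {x0<..})) UNIV = 0\<close> by (simp add: emeasure_density)
  then have "AE x in lborel. ennreal (indicator {x0<..} x * g x) = 0"
    by (subst (asm) nn_integral_0_iff_AE) auto
  then have "AE x in lborel. x \<notin> {x0<..x0 + 1}"
  proof eventually_elim
    case (elim x)
    then show ?case using g_pos[of x] by (auto simp: indicator_def)
  qed
  then have "{x0<..x0 + 1} \<in> null_sets lborel"
    by (subst AE_iff_null_sets) auto
  then show False by (simp add: null_sets_def)
qed

theorem corollary2:
  fixes M :: "'a measure" and Y :: "'a \<Rightarrow> real" and G g \<phi> :: "real \<Rightarrow> real"
    and x0 a \<alpha> :: real
  assumes "prob_space M"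
    and "Y \<in> borel_measurable M"
    and "\<And>\<omega>. \<omega> \<in> space M \<Longrightarrow> 0 \<le> Y \<omega>"
    and "\<And>n::nat. n \<ge> 1 \<Longrightarrow> integrable M (\<lambda>\<omega>. Y \<omega> ^ n)"
    and "G = cdf (distr M borel Y)"
    and "x0 > exp 1"
    and "abs_cont_from_with_density G x0 g"
    and "\<And>x. x \<ge> x0 \<Longrightarrow> g x > 0"
    and "a > 0"
    and "\<alpha> \<in> {0..1}"
    and "\<phi> \<in> {phi1 a \<alpha>, phi2 a \<alpha>, phi3 a \<alpha>}"
    and "Limsup at_top (\<lambda>x. ereal (g ((x + \<phi> x)\<^sup>2) / g (x\<^sup>2))) < 1"
  shows "carleman_condition_nonneg M Y \<and> moment_determinate_nonneg (distr M borel Y)"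
proof -
  interpret prob_space M by fact
  note [measurable] = \<open>Y \<in> borel_measurable M\<close>
  define D where "D = distr M borel Y"
  have D_dist: "real_distribution D" unfolding D_def by (rule real_distribution_distr) simp
  have D_nonneg: "AE x in D. 0 \<le> x"
    unfolding D_def using assms(3) by (subst AE_distr_iff) auto
  have D_int: "integrable D (\<lambda>x. x ^ n)" if "n \<ge> 1" for n :: nat
    unfolding D_def using assms(4)[OF that] by (subst integrable_distr_eq) auto
  have moment_eq: "(\<integral>x. x ^ n \<partial>D) = (\<integral>\<omega>. Y \<omega> ^ n \<partial>M)" for n
    unfolding D_def by (subst integral_distr) auto
  have abs_cont: "abs_cont_from_with_density (cdf D) x0 g"
    using assms(5,7) by (simp add: D_def)
  have "x0 \<ge> 0" using assms(6) exp_gt_zero[of "1::real"] by linarith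
  obtain \<phi>' C X where growth: "C > 0"
    "\<And>x. x \<ge> X \<Longrightarrow> (\<phi> has_real_derivative \<phi>' x) (at x)"
    "\<And>x. x \<ge> X \<Longrightarrow> isCont \<phi>' x"
    "\<And>x. x \<ge> X \<Longrightarrow> \<bar>\<phi>' x\<bar> \<le> C / x"
    "\<And>x. x \<ge> X \<Longrightarrow> 0 \<le> \<phi> x"
    "\<And>x. x \<ge> X \<Longrightarrow> \<phi> x \<le> C * ln x"
    by (rule phi_growth[OF assms(9-11)]) (rule that)
  obtain A where A: "A > 0"
    "\<And>n::nat. n \<ge> 1 \<Longrightarrow> (\<integral>x. x ^ n \<partial>D) \<le> (A * (real n * ln (real n + 2))) ^ (2 * n)"
    by (rule moment_growth[OF D_dist D_nonneg D_int abs_cont assms(8) growth assms(12)]) (assumption | rule that)+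
  have pos: "0 < (\<integral>x. x ^ n \<partial>D)" if "n \<ge> 1" for n :: nat
    by (rule moment_pos_if_density_pos[OF D_dist D_nonneg D_int[OF that] abs_cont assms(8) \<open>x0 \<ge> 0\<close>])
  have carleman: "carleman_condition_nonneg D (\<lambda>x. x)"
    by (rule carleman_condition_if_moment_growth[OF pos A(2,1)])
  moreover have "carleman_condition_nonneg M Y"
    using carleman by (simp only: carleman_condition_nonneg_def moment_eq)
  moreover have "nonneg_distribution_finite_moments D"
    using D_dist D_nonneg D_int by (simp add: nonneg_distribution_finite_moments_def)
  ultimately show ?thesis
    using carleman_imp_moment_determinate_nonneg[of D] unfolding D_def by blast
qed

end
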